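(* Let $I$ be an index set and, for each $n$, let $(\mathbf{X}_n^{(i)})_{i\in I}$ be a family of independent unnormalized finite-moment Wigner matrices of size $n\times n$, with parameters $\beta_i\in\mathbb{R}$. Let $\mathbf{W}_n^{(i)}=n^{-1/2}\mathbf{X}_n^{(i)}$ be the normalized Wigner matrices. Let $I=I_1\sqcup I_2\sqcup I_3\sqcup I_4$ and let $(b_n^{(i)})_{n\ge1}$, $i\in I$, be band widths which are of slow growth for $i\in I_1$, of proportional growth with proper proportion for $i\in I_2$, of proportional growth with full proportion for $i\in I_3$, and fixed ($b_n^{(i)}\equiv b_i$) for $i\in I_4$. Let $\mathcal{O}_n=(\mathbf{\Theta}_n^{(i)})_{i\in I}$ be the corresponding family of normalized random band matrices built from the $\mathbf{X}_n^{(i)}$. Then $\mathcal{O}_n$ converges in traffic distribution as $n\to\infty$. Moreover, the families $(\mathbf{\Theta}_n^{(i)})_{i\in I_1\cup I_3}$ and $(\mathbf{W}_n^{(i)})_{i\in I_1\cup I_3}$ both converge in traffic distribution, and their limiting traffic distributions are identical.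
   Context: Wigner matrices: an unnormalized Wigner matrix $\mathbf{X}_n$ is the $n\times n$ Hermitian matrix with $\mathbf{X}_n(j,k)=X_{j,k}$ for $j\le k$, where $(X_{j,k})_{1\le j<k<\infty}$ and $(X_{j,j})_{j\ge1}$ are independent families of i.i.d. random variables; the $X_{j,k}$ ($j<k$) are complex-valued (possibly real-valued) with $\mathbb{E}X_{j,k}=0$ and $\mathbb{E}|X_{j,k}|^2=1$; the $X_{j,j}$ are real-valued with finite variance. It is finite-moment if all these variables have finite moments of all orders. Its parameter is $\beta=\mathbb{E}[X_{j,k}^2]$ ($j<k$). Random band matrices: for nonnegative integers $b_n$, set $\mathbf{\Xi}_n(j,k)=\mathbf{1}\{|j-k|\le b_n\}\,\mathbf{X}_n(j,k)$. Slow growth: $b_n\to\infty$ and $b_n=o(n)$; then $\mathbf{\Theta}_n=(2b_n)^{-1/2}\mathbf{\Xi}_n$. Proportional growth: $b_n/n\to c\in(0,1]$; then $\mathbf{\Theta}_n=(2c-c^2)^{-1/2}n^{-1/2}\mathbf{\Xi}_n$; full proportion means $c=1$, proper proportion means $c\in(0,1)$. Fixed band width $b_n\equiv b$: $\mathbf{\Theta}_n=(2b+1)^{-1/2}\mathbf{\Xi}_n$. Traffic distribution: a $*$-test graph $T=(V,E,\mathrm{src},\mathrm{tar},\gamma,\varepsilon)$ with labels in $I$ is a finite, connected directed multigraph (loops and multiple edges allowed, $V\ne\emptyset$) with maps $\mathrm{src},\mathrm{tar}:E\to V$, $\gamma:E\to I$, $\varepsilon:E\to\{1,*\}$. For a family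 $\mathfrak{A}_n=(\mathbf{A}_n^{(i)})_{i\in I}$ of random $n\times n$ matrices whose entries have finite moments of all orders, put $$\tau_{\mathfrak{A}_n}(T)=\mathbb{E}\Big[\frac1n\sum_{\phi:V\to[n]}\ \prod_{e\in E}(\mathbf{A}_n^{(\gamma(e))})^{\varepsilon(e)}\big(\phi(\mathrm{tar}(e)),\phi(\mathrm{src}(e))\big)\Big].$$ The linear extension of $\tau_{\mathfrak{A}_n}$ to finite linear combinations of $*$-test graphs is the traffic distribution of $\mathfrak{A}_n$. The sequence $\mathfrak{A}_n$ converges in traffic distribution if $\lim_{n\to\infty}\tau_{\mathfrak{A}_n}(T)$ exists in $\mathbb{C}$ for every $*$-test graph $T$; the limit functional is the limiting traffic distribution. *)

theory Defs
  imports
    "HOL-Probability.Probability"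
    "HOL-Library.Landau_Symbols"
    "HOL-Library.Poly_Mapping"
    "Graph_Theory.Digraph_Component"
    "Jordan_Normal_Form.Schur_Decomposition"
begin

text \<open>Matrices are those of \<^theory>\<open>Jordan_Normal_Form.Matrix\<close>, so that $[n]$ is \<open>{..<n}\<close>
  and indices start at 0.\<close>

section \<open>Wigner matrices\<close>

text \<open>A Wigner matrix is given by one infinite array of entries \<open>X j k\<close>, of which only those with
  \<open>j \<le> k\<close> matter.\<close>

definition triangle :: "(nat \<times> nat) set" where
  "triangle = {(j, k). j \<le> k}"

definition wigner_array :: "'w measure \<Rightarrow> (nat \<Rightarrow> nat \<Rightarrow> 'w \<Rightarrow> complex) \<Rightarrow> bool" where
  "wigner_array M X \<longleftrightarrow>
     prob_space M \<and>
     prob_space.indep_vars M (\<lambda>_. borel) (\<lambda>(j, k). X j k) triangle \<and>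
     (\<forall>j k j' k'. j < k \<and> j' < k' \<longrightarrow> distr M borel (X j k) = distr M borel (X j' k')) \<and>
     (\<forall>j j'. distr M borel (X j j) = distr M borel (X j' j')) \<and>
     (\<forall>j k. j < k \<longrightarrow>
        integrable M (X j k) \<and> (\<integral>\<omega>. X j k \<omega> \<partial>M) = 0 \<and>
        integrable M (\<lambda>\<omega>. (cmod (X j k \<omega>))\<^sup>2) \<and> (\<integral>\<omega>. (cmod (X j k \<omega>))\<^sup>2 \<partial>M) = 1) \<and>
     (\<forall>j. (\<forall>\<omega>\<in>space M. X j j \<omega> \<in> \<real>) \<and> integrable M (\<lambda>\<omega>. (cmod (X j j \<omega>))\<^sup>2))"

definition finite_moment :: "'w measure \<Rightarrow> (nat \<Rightarrow> nat \<Rightarrow> 'w \<Rightarrow> complex) \<Rightarrow> bool" where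
  "finite_moment M X \<longleftrightarrow> (\<forall>j k p. j \<le> k \<longrightarrow> integrable M (\<lambda>\<omega>. cmod (X j k \<omega>) ^ p))"

text \<open>All strictly upper triangular entries of a Wigner array have the same law, so the parameter
  may be read off from any of them.\<close>

definition wigner_parameter :: "'w measure \<Rightarrow> (nat \<Rightarrow> nat \<Rightarrow> 'w \<Rightarrow> complex) \<Rightarrow> complex" where
  "wigner_parameter M X = (\<integral>\<omega>. (X 0 1 \<omega>)\<^sup>2 \<partial>M)"

text \<open>Independence of the arrays themselves, as random elements of the product space over
  the triangle.\<close>

definition independent_arrays ::
    "'w measure \<Rightarrow> 'i set \<Rightarrow> ('i \<Rightarrow> nat \<Rightarrow> nat \<Rightarrow> 'w \<Rightarrow> complex) \<Rightarrow> bool" where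
  "independent_arrays M I X \<longleftrightarrow>
     prob_space.indep_vars M (\<lambda>_. \<Pi>\<^sub>M _\<in>triangle. borel)
       (\<lambda>i \<omega>. \<lambda>(j, k)\<in>triangle. X i j k \<omega>) I"

definition wigner_matrix :: "(nat \<Rightarrow> nat \<Rightarrow> 'w \<Rightarrow> complex) \<Rightarrow> nat \<Rightarrow> 'w \<Rightarrow> complex mat" where
  "wigner_matrix X n \<omega> =
     Matrix.mat n n (\<lambda>(j, k). if j \<le> k then X j k \<omega> else cnj (X k j \<omega>))"

definition normalized_wigner :: "(nat \<Rightarrow> nat \<Rightarrow> 'w \<Rightarrow> complex) \<Rightarrow> nat \<Rightarrow> 'w \<Rightarrow> complex mat" where
  "normalized_wigner X n \<omega> = complex_of_real (1 / sqrt (real n)) \<cdot>\<^sub>m wigner_matrix X n \<omega>"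

section \<open>Random band matrices\<close>

definition band_matrix ::
    "nat \<Rightarrow> (nat \<Rightarrow> nat \<Rightarrow> 'w \<Rightarrow> complex) \<Rightarrow> nat \<Rightarrow> 'w \<Rightarrow> complex mat" where
  "band_matrix b X n \<omega> =
     Matrix.mat n n (\<lambda>(j, k). of_bool (\<bar>int j - int k\<bar> \<le> int b) * wigner_matrix X n \<omega> $$ (j, k))"

definition slow_growth :: "(nat \<Rightarrow> nat) \<Rightarrow> bool" where
  "slow_growth b \<longleftrightarrow>
     filterlim b at_top sequentially \<and> (\<lambda>n. real (b n)) \<in> o[sequentially](\<lambda>n. real n)"

definition proportional_growth :: "(nat \<Rightarrow> nat) \<Rightarrow> real \<Rightarrow> bool" where
  "proportional_growth b c \<longleftrightarrow>
     0 < c \<and> c \<le> 1 \<and> (\<lambda>n. real (b n) / real n) \<longlonglongrightarrow> c"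

definition slow_band ::
    "(nat \<Rightarrow> nat) \<Rightarrow> (nat \<Rightarrow> nat \<Rightarrow> 'w \<Rightarrow> complex) \<Rightarrow> nat \<Rightarrow> 'w \<Rightarrow> complex mat" where
  "slow_band b X n \<omega> =
     complex_of_real (1 / sqrt (2 * real (b n))) \<cdot>\<^sub>m band_matrix (b n) X n \<omega>"

definition proportional_band ::
    "(nat \<Rightarrow> nat) \<Rightarrow> real \<Rightarrow> (nat \<Rightarrow> nat \<Rightarrow> 'w \<Rightarrow> complex) \<Rightarrow> nat \<Rightarrow> 'w \<Rightarrow> complex mat" where
  "proportional_band b c X n \<omega> =
     complex_of_real (1 / (sqrt (2 * c - c\<^sup>2) * sqrt (real n))) \<cdot>\<^sub>m band_matrix (b n) X n \<omega>"

definition fixed_band ::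
    "nat \<Rightarrow> (nat \<Rightarrow> nat \<Rightarrow> 'w \<Rightarrow> complex) \<Rightarrow> nat \<Rightarrow> 'w \<Rightarrow> complex mat" where
  "fixed_band b X n \<omega> = complex_of_real (1 / sqrt (2 * real b + 1)) \<cdot>\<^sub>m band_matrix b X n \<omega>"

section \<open>Traffic distributions\<close>

text \<open>Every finite multigraph is isomorphic to one whose vertices and edges are natural numbers.
  The maps src and tar are \<^const>\<open>tail\<close> and \<^const>\<open>head\<close>, and \<open>starred e\<close> encodes
  $\varepsilon(e) = *$.\<close>

record 'i star_test_graph =
  graph :: "(nat, nat) pre_digraph"
  label :: "nat \<Rightarrow> 'i"
  starred :: "nat \<Rightarrow> bool"

text \<open>Connectedness is that of the underlying undirected graph and includes having a vertex.\<close>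

definition star_test_graphs :: "'i set \<Rightarrow> 'i star_test_graph set" where
  "star_test_graphs I =
     {T. fin_digraph (graph T) \<and> Digraph_Component.connected (graph T) \<and>
         label T ` arcs (graph T) \<subseteq> I}"

definition graph_moment ::
    "'w measure \<Rightarrow> nat \<Rightarrow> ('i \<Rightarrow> 'w \<Rightarrow> complex mat) \<Rightarrow> 'i star_test_graph \<Rightarrow> complex" where
  "graph_moment M n A T =
     (\<integral>\<omega>. 1 / of_nat n *
        (\<Sum>\<phi>\<in>verts (graph T) \<rightarrow>\<^sub>E {..<n}. \<Prod>e\<in>arcs (graph T).
           (if starred T e then mat_adjoint (A (label T e) \<omega>) else A (label T e) \<omega>)
             $$ (\<phi> (head (graph T) e), \<phi> (tail (graph T) e))) \<partial>M)"

text \<open>The linear extension to finite linear combinations of test graphs.\<close>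

definition traffic_distribution ::
    "'w measure \<Rightarrow> nat \<Rightarrow> ('i \<Rightarrow> 'w \<Rightarrow> complex mat) \<Rightarrow> ('i star_test_graph \<Rightarrow>\<^sub>0 complex) \<Rightarrow> complex"
  where
  "traffic_distribution M n A t =
     (\<Sum>T\<in>Poly_Mapping.keys t. Poly_Mapping.lookup t T * graph_moment M n A T)"

definition converges_in_traffic ::
    "'w measure \<Rightarrow> 'i set \<Rightarrow> (nat \<Rightarrow> 'i \<Rightarrow> 'w \<Rightarrow> complex mat) \<Rightarrow> bool" where
  "converges_in_traffic M I A \<longleftrightarrow>
     (\<forall>T\<in>star_test_graphs I. convergent (\<lambda>n. graph_moment M n (A n) T))"

definition limiting_traffic_distribution ::
    "'w measure \<Rightarrow> (nat \<Rightarrow> 'i \<Rightarrow> 'w \<Rightarrow> complex mat) \<Rightarrow> ('i star_test_graph \<Rightarrow>\<^sub>0 complex) \<Rightarrow> complex"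
  where
  "limiting_traffic_distribution M A t = lim (\<lambda>n. traffic_distribution M n (A n) t)"

end

theory Submission
  imports Defs
begin

text \<open>
  Expand a graph moment over the maps \<open>\<phi>\<close> from the vertices to positions. The expectation attached
  to \<open>\<phi>\<close> depends only on the coincidences and the order of positions joined by edges, so maps are
  sorted by their pattern, the list of all differences of positions that are at most a bound of the
  fixed band widths. Within a pattern the vertices form rigid classes, and only edges with a growing
  band width join different classes. Centring forces every such edge to be accompanied by a twin.
  A spanning tree of the classes in which each edge is doubled uses up exactly the normalization of
  its edges, and each further growing edge contributes a factor that tends to \<open>0\<close>; so only doubled trees
  survive. For those the expectation is constant on the pattern, since a pair of twins contributes
  \<open>1\<close> or the real parameter \<open>\<beta>\<close> irrespective of the order of its ends.

  The sum over a doubled tree is computed by removing leaves. Removing a leaf averages a function of the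
  position over a band, and such averages preserve the convergence of functions on \<open>{..<n}\<close> along
  sequences \<open>k n / n \<longlonglongrightarrow> x\<close>: a slow band reproduces the limit function and a proportional band integrates
  it over an interval. Slow bands and full proportion moreover preserve constant limit functions.
  Hence a family that switches arbitrarily with \<open>n\<close> between \<open>\<Theta>\<close> and \<open>W\<close> converges too, which
  identifies the two limits.
\<close>

section \<open>Sequences of functions with a macroscopic profile\<close>

text \<open>Two obstacles shape the proof. Edges of fixed width carry no decaying scale and tie
  positions to a bounded distance, so sorting maps by coincidences alone is too coarse; the pattern
  records all short differences instead. With proper proportion the sum over a leaf depends on how
  far its neighbour lies from the ends of \<open>{0..<n}\<close>, so leaf removal yields functions
  of the position rather than constants. A profile is the continuous convergence of such functions:
  convergence along every sequence with the given ratio carries the uniformity that averaging over a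
  moving window needs, and it passes to products at once. It is asked only inside the open unit
  interval, because windows are cut off at the ends; the uniform bound takes care of the ends under
  integration. Scales balance as follows. A doubled tree on m classes has 2(m - 1) edges. Each pair
  carries the squared scale, which the number of positions in the band compensates, and the division
  by n compensates the position of the root. The two limits are compared without a formula for
  either of them.\<close>

definition has_profile :: "(nat \<Rightarrow> int \<Rightarrow> real) \<Rightarrow> (real \<Rightarrow> real) \<Rightarrow> bool" where
  "has_profile g G \<longleftrightarrow> (\<exists>B. \<forall>n x. \<bar>g n x\<bar> \<le> B) \<and>
     (\<forall>x\<in>{0<..<1}. \<forall>k. (\<lambda>n. real_of_int (k n) / real n) \<longlonglongrightarrow> x \<longrightarrow> (\<lambda>n. g n (k n)) \<longlonglongrightarrow> G x)"

lemma has_profileD: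
  "has_profile g G \<Longrightarrow> 0 < x \<Longrightarrow> x < 1 \<Longrightarrow> (\<lambda>n. real_of_int (k n) / real n) \<longlonglongrightarrow> x \<Longrightarrow> (\<lambda>n. g n (k n)) \<longlonglongrightarrow> G x"
  by (auto simp: has_profile_def)

lemma has_profile_mult:
  assumes "has_profile g G" "has_profile h H"
  shows "has_profile (\<lambda>n x. g n x * h n x) (\<lambda>x. G x * H x)"
proof -
  obtain B C where B: "\<And>n x. \<bar>g n x\<bar> \<le> B" and C: "\<And>n x. \<bar>h n x\<bar> \<le> C"
    using assms by (auto simp: has_profile_def)
  have "\<bar>g n x * h n x\<bar> \<le> B * C" for n x
    unfolding abs_mult by (rule mult_mono) (use B C order_trans[OF abs_ge_zero B] in auto)
  then show ?thesis
    using assms unfolding has_profile_def by (auto intro!: tendsto_mult exI[of _ "B * C"])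
qed

lemma has_profile_const: "has_profile (\<lambda>_ _. z) (\<lambda>_. z)"
  by (auto simp: has_profile_def)

section \<open>Averages over positions as integrals of step functions\<close>

lemma step_floor_eq:
  fixes f :: "int \<Rightarrow> real"
  assumes "n > 0"
  shows "indicator {0..<1} t * f \<lfloor>real n * t\<rfloor> =
    (\<Sum>y\<in>{0..<int n}. f y * indicator {y / real n..<(y + 1) / real n} t)"
proof -
  have iff: "t \<in> {real_of_int y / real n..<(real_of_int y + 1) / real n} \<longleftrightarrow> y = \<lfloor>real n * t\<rfloor>" for y
    using assms by (auto simp: pos_divide_le_eq pos_less_divide_eq eq_commute[of y] floor_eq_iff mult.commute[of t])
  have rng: "\<lfloor>real n * t\<rfloor> \<in> {0..<int n} \<longleftrightarrow> t \<in> {0..<1}"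
    using assms by (auto simp: floor_less_iff zero_le_mult_iff)
  have "(\<Sum>y\<in>{0..<int n}. f y * indicator {y / real n..<(y + 1) / real n} t)
     = (\<Sum>y\<in>{0..<int n}. if y = \<lfloor>real n * t\<rfloor> then f y else 0)"
  proof (intro sum.cong refl)
    fix y :: int
    have "indicator {y / real n..<(y + 1) / real n} t = (if y = \<lfloor>real n * t\<rfloor> then 1 else 0 :: real)"
      using iff[of y] by (simp add: indicator_def del: atLeastLessThan_iff)
    then show "f y * indicator {y / real n..<(y + 1) / real n} t = (if y = \<lfloor>real n * t\<rfloor> then f y else 0)"
      by simp
  qed
  also have "\<dots> = indicator {0..<1} t * f \<lfloor>real n * t\<rfloor>"
    using rng by (simp only: sum.delta finite_atLeastLessThan_int) (simp add: indicator_def)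
  finally show ?thesis by simp
qed

lemma step_floor_integral:
  fixes f :: "int \<Rightarrow> real"
  assumes "n > 0"
  shows "(\<integral>t. indicator {0..<1} t * f \<lfloor>real n * t\<rfloor> \<partial>lborel) = (\<Sum>y\<in>{0..<int n}. f y) / real n"
    and "(\<lambda>t. indicator {0..<1} t * f \<lfloor>real n * t\<rfloor>) \<in> borel_measurable lborel"
proof -
  have len: "measure lborel {real_of_int y / real n..<(real_of_int y + 1) / real n} = 1 / real n" for y
    using assms by (simp add: divide_simps)
  have "(\<integral>t. indicator {0..<1} t * f \<lfloor>real n * t\<rfloor> \<partial>lborel) =
      (\<Sum>y\<in>{0..<int n}. f y * measure lborel {y / real n..<(y + 1) / real n})"
    unfolding step_floor_eq[OF assms]
    by (subst Bochner_Integration.integral_sum) (auto simp: divide_right_mono)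
  then show "(\<integral>t. indicator {0..<1} t * f \<lfloor>real n * t\<rfloor> \<partial>lborel) = (\<Sum>y\<in>{0..<int n}. f y) / real n"
    by (simp add: len sum_divide_distrib)
  show "(\<lambda>t. indicator {0..<1} t * f \<lfloor>real n * t\<rfloor>) \<in> borel_measurable lborel"
    unfolding step_floor_eq[OF assms] by measurable
qed

text \<open>The average over \<open>{0..<int n}\<close> is the integral of a step function on the
  unit interval, so dominated convergence applies. Convergence almost everywhere suffices, which
  leaves room for the jumps of band indicators.\<close>

lemma average_tendsto_integral:
  fixes f :: "nat \<Rightarrow> int \<Rightarrow> real"
  assumes B: "\<And>n y. \<bar>f n y\<bar> \<le> B"
    and lim: "AE t in lborel. t \<in> {0<..<1} \<longrightarrow> (\<lambda>n. f n \<lfloor>real n * t\<rfloor>) \<longlonglongrightarrow> F t"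
    and meas: "(\<lambda>t. indicator {0<..<1} t * F t) \<in> borel_measurable lborel"
  shows "(\<lambda>n. (\<Sum>y\<in>{0..<int n}. f n y) / real n) \<longlonglongrightarrow> (\<integral>t. indicator {0<..<1} t * F t \<partial>lborel)"
proof -
  \<comment> \<open>The index is shifted because the step function has the integral of
    \<open>f 0 0\<close> at size 0, whereas the average there is 0 by the convention on division by
    0.\<close>
  define s where "s n t = indicator {0..<1} t * f (Suc n) \<lfloor>real (Suc n) * t\<rfloor>" for n t
  have "(\<lambda>n. \<integral>t. s n t \<partial>lborel) \<longlonglongrightarrow> (\<integral>t. indicator {0<..<1} t * F t \<partial>lborel)"
  proof (rule integral_dominated_convergence[where w = "\<lambda>t. B * indicator {0..1} t"])
    show "s n \<in> borel_measurable lborel" for n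
      unfolding s_def by (rule step_floor_integral) simp
    show "AE t in lborel. (\<lambda>n. s n t) \<longlonglongrightarrow> indicator {0<..<1} t * F t"
      \<comment> \<open>The step function is supported on a half-open interval and the limit on the
        open one; they may differ at the null point 0.\<close>
      using lim AE_lborel_singleton[of 0]
    proof eventually_elim
      case (elim t)
      show ?case
      proof (cases "t \<in> {0<..<1}")
        case True
        then have "(\<lambda>n. f (Suc n) \<lfloor>real (Suc n) * t\<rfloor>) \<longlonglongrightarrow> F t"
          using elim LIMSEQ_Suc by blast
        with True show ?thesis by (simp add: s_def)
      next
        case False
        with elim show ?thesis by (auto simp: s_def)
      qed
    qed
    show "AE t in lborel. norm (s n t) \<le> B * indicator {0..1} t" for n
      using B order_trans[OF abs_ge_zero B] by (auto simp: s_def indicator_def)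
  qed (use meas in auto)
  then have "(\<lambda>n. (\<Sum>y\<in>{0..<int (Suc n)}. f (Suc n) y) / real (Suc n))
      \<longlonglongrightarrow> (\<integral>t. indicator {0<..<1} t * F t \<partial>lborel)"
    unfolding s_def by (subst (asm) step_floor_integral(1)) simp_all
  then show ?thesis by (rule LIMSEQ_imp_Suc)
qed

lemma floor_ratio_tendsto: "(\<lambda>n. real_of_int \<lfloor>real n * t\<rfloor> / real n) \<longlonglongrightarrow> t"
proof (rule tendsto_sandwich[where f = "\<lambda>n. t - 1 / real n" and h = "\<lambda>n. t"])
  show "\<forall>\<^sub>F n in sequentially. t - 1 / real n \<le> real_of_int \<lfloor>real n * t\<rfloor> / real n"
    using eventually_gt_at_top[of 0] 
  proof eventually_elim
    case (elim n)
    have "(real n * t - 1) / real n \<le> real_of_int \<lfloor>real n * t\<rfloor> / real n"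
      by (intro divide_right_mono) linarith+
    then show ?case using elim by (simp add: diff_divide_distrib)
  qed
  show "\<forall>\<^sub>F n in sequentially. real_of_int \<lfloor>real n * t\<rfloor> / real n \<le> t"
    using eventually_gt_at_top[of 0] by eventually_elim (simp add: field_simps)
  show "(\<lambda>n. t - 1 / real n) \<longlonglongrightarrow> t"
    using tendsto_diff[OF tendsto_const lim_1_over_n, of t] by simp
qed simp

text \<open>The definition of a profile asks no regularity of \<open>G\<close>. Inside the unit
  interval, however, \<open>G\<close> is the pointwise limit of the step functions that read
  \<open>g\<close> at the integer part of n t.\<close>

lemma has_profile_measurable:
  assumes "has_profile g G"
  shows "(\<lambda>t. indicator {0<..<1} t * G t) \<in> borel_measurable lborel"
proof (rule borel_measurable_LIMSEQ_real)
  show "(\<lambda>n. indicator {0<..<1} t * (indicator {0..<1} t * g (Suc n) \<lfloor>real (Suc n) * t\<rfloor>)) \<longlonglongrightarrow>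
      indicator {0<..<1} t * G t" for t
  proof (cases "t \<in> {0<..<1}")
    case True
    then have "(\<lambda>n. g n \<lfloor>real n * t\<rfloor>) \<longlonglongrightarrow> G t"
      using has_profileD[OF assms _ _ floor_ratio_tendsto] by simp
    then have "(\<lambda>n. g (Suc n) \<lfloor>real (Suc n) * t\<rfloor>) \<longlonglongrightarrow> G t"
      by (rule LIMSEQ_Suc)
    with True show ?thesis by simp
  qed simp
  show "(\<lambda>t. indicator {0<..<1} t * (indicator {0..<1} t * g (Suc n) \<lfloor>real (Suc n) * t\<rfloor>)) \<in> borel_measurable lborel" for n
    by (intro borel_measurable_times step_floor_integral(2)) auto
qed

lemma has_profile_average:
  assumes "has_profile g G"
  shows "(\<lambda>n. (\<Sum>y\<in>{0..<int n}. g n y) / real n) \<longlonglongrightarrow> (\<integral>t. indicator {0<..<1} t * G t \<partial>lborel)"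
proof -
  obtain B where "\<And>n y. \<bar>g n y\<bar> \<le> B" using assms by (auto simp: has_profile_def)
  then show ?thesis
    by (rule average_tendsto_integral[OF _ _ has_profile_measurable[OF assms]])
      (auto intro!: has_profileD[OF assms _ _ floor_ratio_tendsto])
qed

lemma shift_ratio_tendsto:
  assumes "(\<lambda>n. real_of_int (k n) / real n) \<longlonglongrightarrow> x"
  shows "(\<lambda>n. real_of_int (k n + d) / real n) \<longlonglongrightarrow> x"
proof -
  have "(\<lambda>n. real_of_int (k n) / real n + real_of_int d * (1 / real n)) \<longlonglongrightarrow> x + of_int d * 0"
    by (intro tendsto_intros assms lim_1_over_n)
  then show ?thesis by (simp add: add_divide_distrib)
qed

text \<open>A bounded offset can push a position out of range only near the two ends, which no
  sequence with an interior ratio approaches.\<close>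

lemma has_profile_inside:
  "has_profile (\<lambda>n x. of_bool (0 \<le> x + d \<and> x + d < int n)) (\<lambda>_. 1)"
  unfolding has_profile_def
proof (intro conjI ballI allI impI)
  fix x :: real and k :: "nat \<Rightarrow> int"
  assume x: "x \<in> {0<..<1}" and "(\<lambda>n. real_of_int (k n) / real n) \<longlonglongrightarrow> x"
  then have lim: "(\<lambda>n. real_of_int (k n + d) / real n) \<longlonglongrightarrow> x" by (intro shift_ratio_tendsto)
  have "\<forall>\<^sub>F n in sequentially. real_of_int (k n + d) / real n > 0"
    "\<forall>\<^sub>F n in sequentially. real_of_int (k n + d) / real n < 1"
    using x order_tendstoD[OF lim] by auto
  then have "\<forall>\<^sub>F n in sequentially. of_bool (0 \<le> k n + d \<and> k n + d < int n) = (1::real)"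
    using eventually_gt_at_top[of 0]
  proof eventually_elim
    case (elim n)
    then have "0 < real_of_int (k n + d)" "real_of_int (k n + d) < real_of_int (int n)"
      by (simp_all add: zero_less_divide_iff divide_less_eq)
    then have "0 < k n + d" "k n + d < int n" by linarith+
    then show ?case by simp
  qed
  then show "(\<lambda>n. of_bool (0 \<le> k n + d \<and> k n + d < int n)) \<longlonglongrightarrow> (1::real)"
    by (rule tendsto_eventually)
qed (auto intro!: exI[of _ 1])

text \<open>This is the sum over the position \<open>y\<close> of a leaf whose neighbour sits at
  \<open>x\<close>. The two twin edges joining them contribute two factors \<open>a n\<close> and
  one common indicator, hence the square; \<open>d\<close> is the difference of the offsets at the
  two ends.\<close>

definition band_average ::
  "(nat \<Rightarrow> real) \<Rightarrow> (nat \<Rightarrow> nat) \<Rightarrow> int \<Rightarrow> (nat \<Rightarrow> int \<Rightarrow> real) \<Rightarrow> nat \<Rightarrow> int \<Rightarrow> real" where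
  "band_average a w d g n x =
     (\<Sum>y\<in>{0..<int n}. (a n)\<^sup>2 * of_bool (\<bar>x - y + d\<bar> \<le> int (w n)) * g n y)"

lemma band_average_window:
  "band_average a w d g n x = (a n)\<^sup>2 * (\<Sum>y\<in>{0..<int n} \<inter> {x + d - int (w n)..x + d + int (w n)}. g n y)"
proof -
  have "band_average a w d g n x =
      (\<Sum>y\<in>{0..<int n}. if y \<in> {x + d - int (w n)..x + d + int (w n)} then (a n)\<^sup>2 * g n y else 0)"
    unfolding band_average_def by (intro sum.cong refl) auto
  also have "\<dots> = (a n)\<^sup>2 * (\<Sum>y\<in>{0..<int n} \<inter> {x + d - int (w n)..x + d + int (w n)}. g n y)"
    by (simp only: sum.inter_restrict[symmetric] finite_atLeastLessThan_int sum_distrib_left)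
  finally show ?thesis .
qed

text \<open>The window holds 2 b + 1 points, each of weight 1 / (2 b), so its mass tends to 1
  because b tends to infinity. Its width is o(n), so every point in it has the same limiting ratio
  as the centre.\<close>

lemma has_profile_slow_average:
  assumes g: "has_profile g G" and b: "slow_growth b"
  shows "has_profile (band_average (\<lambda>n. 1 / sqrt (2 * real (b n))) b d g) G"
  unfolding has_profile_def
proof (intro conjI ballI allI impI)
  obtain B where B: "\<And>n y. \<bar>g n y\<bar> \<le> B" using g by (auto simp: has_profile_def)
  then have B0: "0 \<le> B" using order_trans[OF abs_ge_zero] by blast
  let ?a = "\<lambda>n. 1 / sqrt (2 * real (b n))"
  let ?A = "\<lambda>n x. {0..<int n} \<inter> {x + d - int (b n)..x + d + int (b n)}"
  have sq: "(?a n)\<^sup>2 = 1 / (2 * real (b n))" for n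
    by (simp add: power_divide)
  show "\<exists>B. \<forall>n x. \<bar>band_average ?a b d g n x\<bar> \<le> B"
  proof (intro exI allI)
    fix n x
    have "\<bar>\<Sum>y\<in>?A n x. g n y\<bar> \<le> (\<Sum>y\<in>?A n x. B)"
      by (rule order_trans[OF sum_abs sum_mono]) (rule B)
    also have "\<dots> \<le> (2 * real (b n) + 1) * B"
    proof -
      have "card (?A n x) \<le> card {x + d - int (b n)..x + d + int (b n)}"
        by (rule card_mono) auto
      then have "real (card (?A n x)) \<le> 2 * real (b n) + 1" by simp
      then show ?thesis using B0 by (simp add: mult_right_mono)
    qed
    finally have "\<bar>\<Sum>y\<in>?A n x. g n y\<bar> \<le> (2 * real (b n) + 1) * B" .
    \<comment> \<open>The mass (2 b + 1) / (2 b) is at most 2 for positive b. For b = 0 the scale is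
      0 by the convention on division by 0.\<close>
    moreover have "1 / (2 * real (b n)) * ((2 * real (b n) + 1) * B) \<le> 2 * B"
    proof (cases "b n = 0")
      case False
      then have "B \<le> B * (2 * real (b n))" using B0 mult_left_mono[of 1 "2 * real (b n)" B] by simp
      with False show ?thesis by (simp add: field_simps)
    qed (use B0 in simp)
    ultimately show "\<bar>band_average ?a b d g n x\<bar> \<le> 2 * B"
      unfolding band_average_window sq abs_mult
      by (smt (verit) mult_left_mono zero_le_divide_1_iff of_nat_0_le_iff abs_of_nonneg)
  qed
next
  fix x :: real and k :: "nat \<Rightarrow> int"
  let ?a = "\<lambda>n. 1 / sqrt (2 * real (b n))"
  assume x: "x \<in> {0<..<1}" and k: "(\<lambda>n. real_of_int (k n) / real n) \<longlonglongrightarrow> x"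
  define W where "W n = {k n + d - int (b n)..k n + d + int (b n)}" for n
  have b_inf: "filterlim (\<lambda>n. real (b n)) at_top sequentially"
    using b filterlim_compose[OF filterlim_real_sequentially] by (auto simp: slow_growth_def)
  have b_small: "(\<lambda>n. real (b n) / real n) \<longlonglongrightarrow> 0"
    using b unfolding slow_growth_def by (auto dest!: smalloD_tendsto)
  have kd: "(\<lambda>n. real_of_int (k n + d) / real n) \<longlonglongrightarrow> x" using k by (rule shift_ratio_tendsto)
  \<comment> \<open>Any selection from the windows has ratio tending to \<open>x\<close>; the
    assumption b = o(n) enters here.\<close>
  have near: "(\<lambda>n. real_of_int (z n) / real n) \<longlonglongrightarrow> x" if "\<And>n. z n \<in> W n" for z
  proof (rule tendsto_sandwich)
    show "\<forall>\<^sub>F n in sequentially. real_of_int (k n + d) / real n - real (b n) / real n \<le> real_of_int (z n) / real n"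
      unfolding diff_divide_distrib[symmetric]
      by (intro always_eventually allI divide_right_mono) (use that in \<open>auto simp: W_def, smt (verit) of_int_diff of_int_le_iff of_int_of_nat_eq of_int_add\<close>)
    show "\<forall>\<^sub>F n in sequentially. real_of_int (z n) / real n \<le> real_of_int (k n + d) / real n + real (b n) / real n"
      unfolding add_divide_distrib[symmetric]
      by (intro always_eventually allI divide_right_mono) (use that in \<open>auto simp: W_def, smt (verit) of_int_diff of_int_le_iff of_int_of_nat_eq of_int_add\<close>)
    show "(\<lambda>n. real_of_int (k n + d) / real n - real (b n) / real n) \<longlonglongrightarrow> x"
      using tendsto_diff[OF kd b_small] by simp
    show "(\<lambda>n. real_of_int (k n + d) / real n + real (b n) / real n) \<longlonglongrightarrow> x"
      using tendsto_add[OF kd b_small] by simp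
  qed
  have fin: "finite (W n)" "W n \<noteq> {}" "card (W n) = 2 * b n + 1" for n by (auto simp: W_def)
  have inside: "\<forall>\<^sub>F n in sequentially. W n \<subseteq> {0..<int n}"
  proof -
    have lo: "\<forall>\<^sub>F n in sequentially. real_of_int (k n + d - int (b n)) / real n > 0"
      by (rule order_tendstoD(1)[OF near]) (use x in \<open>auto simp: W_def\<close>)
    have hi: "\<forall>\<^sub>F n in sequentially. real_of_int (k n + d + int (b n)) / real n < 1"
      by (rule order_tendstoD(2)[OF near]) (use x in \<open>auto simp: W_def\<close>)
    from lo hi eventually_gt_at_top[of 0] show ?thesis
    proof eventually_elim
      case (elim n)
      then have "0 < real_of_int (k n + d - int (b n))" "real_of_int (k n + d + int (b n)) < real_of_int (int n)"
        by (simp_all add: zero_less_divide_iff divide_less_eq)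
      then have "0 < k n + d - int (b n)" "k n + d + int (b n) < int n" by linarith+
      then show ?case by (auto simp: W_def)
    qed
  qed
  \<comment> \<open>Following the worst point of each window shows that \<open>g n\<close> is uniformly close to \<open>G x\<close> there.\<close>
  have "\<exists>z\<in>W n. \<forall>y\<in>W n. \<bar>g n y - G x\<bar> \<le> \<bar>g n z - G x\<bar>" for n
  proof -
    have "Max ((\<lambda>y. \<bar>g n y - G x\<bar>) ` W n) \<in> (\<lambda>y. \<bar>g n y - G x\<bar>) ` W n"
      by (rule Max_in) (use fin in auto)
    then obtain z where "z \<in> W n" and m: "Max ((\<lambda>y. \<bar>g n y - G x\<bar>) ` W n) = \<bar>g n z - G x\<bar>" by auto
    moreover have "\<bar>g n y - G x\<bar> \<le> \<bar>g n z - G x\<bar>" if "y \<in> W n" for y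
      unfolding m[symmetric] by (rule Max_ge) (use that fin in auto)
    ultimately show ?thesis by blast
  qed
  then obtain z where z: "z n \<in> W n" "\<And>y. y \<in> W n \<Longrightarrow> \<bar>g n y - G x\<bar> \<le> \<bar>g n (z n) - G x\<bar>" for n
    by metis
  have err0: "(\<lambda>n. \<bar>g n (z n) - G x\<bar>) \<longlonglongrightarrow> 0"
    using has_profileD[OF g _ _ near[OF z(1)]] x by (auto simp: LIM_zero_iff tendsto_rabs_zero_iff)
  have inv0: "(\<lambda>n. 1 / (2 * real (b n))) \<longlonglongrightarrow> 0"
    by (intro tendsto_divide_0[OF tendsto_const] filterlim_at_top_imp_at_infinity
        filterlim_tendsto_pos_mult_at_top[OF tendsto_const _ b_inf]) simp
  have "(\<lambda>n. band_average ?a b d g n (k n) - G x) \<longlonglongrightarrow> 0"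
  proof (rule Lim_null_comparison)
    show "(\<lambda>n. 2 * \<bar>g n (z n) - G x\<bar> + 1 / (2 * real (b n)) * \<bar>G x\<bar>) \<longlonglongrightarrow> 0"
      using tendsto_add[OF tendsto_mult[OF tendsto_const[of 2] err0] tendsto_mult[OF inv0 tendsto_const[of "\<bar>G x\<bar>"]]] by simp
    show "\<forall>\<^sub>F n in sequentially. norm (band_average ?a b d g n (k n) - G x) \<le>
        2 * \<bar>g n (z n) - G x\<bar> + 1 / (2 * real (b n)) * \<bar>G x\<bar>"
      using inside filterlim_at_top_dense[THEN iffD1, OF b_inf, rule_format, of 0]
    proof eventually_elim
      case (elim n)
      then have b0: "b n > 0" and sub: "{0..<int n} \<inter> W n = W n" by auto
      have "\<bar>\<Sum>y\<in>W n. g n y - G x\<bar> \<le> (\<Sum>y\<in>W n. \<bar>g n (z n) - G x\<bar>)"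
        by (rule order_trans[OF sum_abs sum_mono]) (rule z(2))
      then have le: "\<bar>\<Sum>y\<in>W n. g n y - G x\<bar> \<le> (2 * real (b n) + 1) * \<bar>g n (z n) - G x\<bar>"
        using fin(3)[of n] by (simp add: add.commute)
      \<comment> \<open>The last summand is the excess mass: the window has one point more than the
        normalization 2 b counts.\<close>
      have eq: "band_average ?a b d g n (k n) - G x =
          1 / (2 * real (b n)) * (\<Sum>y\<in>W n. g n y - G x) + 1 / (2 * real (b n)) * G x"
        unfolding band_average_window W_def[symmetric] sub
        using b0 fin(3)[of n] by (simp add: power_divide sum_subtractf field_simps)
      have "\<bar>1 / (2 * real (b n)) * (\<Sum>y\<in>W n. g n y - G x)\<bar> \<le>
          1 / (2 * real (b n)) * ((2 * real (b n) + 1) * \<bar>g n (z n) - G x\<bar>)"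
        unfolding abs_mult using le by (intro mult_mono) auto
      also have "\<dots> = (1 + 1 / (2 * real (b n))) * \<bar>g n (z n) - G x\<bar>"
        using b0 by (simp add: field_simps)
      also have "\<dots> \<le> 2 * \<bar>g n (z n) - G x\<bar>"
        using b0 by (intro mult_right_mono) auto
      finally have le2: "\<bar>1 / (2 * real (b n)) * (\<Sum>y\<in>W n. g n y - G x)\<bar> \<le> 2 * \<bar>g n (z n) - G x\<bar>" .
      show ?case unfolding eq real_norm_def
        by (rule order_trans[OF abs_triangle_ineq add_mono[OF le2]]) (simp add: abs_mult)
    qed
  qed
  then show "(\<lambda>n. band_average ?a b d g n (k n)) \<longlonglongrightarrow> G x"
    by (simp add: LIM_zero_iff)
qed

text \<open>The number is the area 1 - (1 - c)^2 of the band of half-width c in the unit square, the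
  limiting fraction of entries kept by the band. Positivity is seen from the factorization c (2 -
  c).\<close>

lemma proportional_variance_pos:
  fixes c :: real
  assumes "0 < c" "c \<le> 1"
  shows "2 * c - c\<^sup>2 > 0"
proof -
  have "2 * c - c\<^sup>2 = c * (2 - c)" by (simp add: power2_eq_square algebra_simps)
  then show ?thesis using assms by simp
qed

text \<open>The band has macroscopic width, so the average is a Riemann sum of a product of an
  indicator with \<open>g\<close>. For c < 1 the interval of half-width c around \<open>x\<close>
  may stick out of the unit interval, which makes the limit depend on \<open>x\<close> even when
  \<open>G\<close> is constant.\<close>

lemma has_profile_proportional_average:
  assumes g: "has_profile g G" and w: "proportional_growth w c"
  shows "has_profile (band_average (\<lambda>n. 1 / (sqrt (2 * c - c\<^sup>2) * sqrt (real n))) w d g)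
    (\<lambda>x. (\<integral>t. indicator {0<..<1} t * (of_bool (\<bar>x - t\<bar> < c) * G t) \<partial>lborel) / (2 * c - c\<^sup>2))"
  unfolding has_profile_def
proof (intro conjI ballI allI impI)
  obtain B where B: "\<And>n y. \<bar>g n y\<bar> \<le> B" using g by (auto simp: has_profile_def)
  then have B0: "0 \<le> B" using order_trans[OF abs_ge_zero] by blast
  let ?a = "\<lambda>n. 1 / (sqrt (2 * c - c\<^sup>2) * sqrt (real n))"
  from w have c: "0 < c" "c \<le> 1" and lim_w: "(\<lambda>n. real (w n) / real n) \<longlonglongrightarrow> c"
    by (auto simp: proportional_growth_def)
  have pos: "2 * c - c\<^sup>2 > 0" using c by (rule proportional_variance_pos)
  have sq: "(?a n)\<^sup>2 = 1 / (2 * c - c\<^sup>2) / real n" for n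
    using pos by (simp add: power_divide power_mult_distrib)
  define f where "f x n y = of_bool (\<bar>x - y + d\<bar> \<le> int (w n)) * g n y" for x n y
  have fB: "\<bar>f x n y\<bar> \<le> B" for x n y using B[of n y] B0 by (auto simp: f_def abs_mult)
  have eq: "band_average ?a w d g n x = (\<Sum>y\<in>{0..<int n}. f x n y) / real n / (2 * c - c\<^sup>2)" for n x
    unfolding band_average_def sq f_def sum_divide_distrib by (intro sum.cong refl) simp
  show "\<exists>B. \<forall>n x. \<bar>band_average ?a w d g n x\<bar> \<le> B"
  proof (intro exI allI)
    fix n x
    have "\<bar>\<Sum>y\<in>{0..<int n}. f x n y\<bar> \<le> (\<Sum>y\<in>{0..<int n}. B)"
      by (rule order_trans[OF sum_abs sum_mono]) (rule fB)
    then have "\<bar>(\<Sum>y\<in>{0..<int n}. f x n y) / real n\<bar> \<le> B"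
      using B0 by (cases "n = 0") (auto simp: abs_divide field_simps)
    then show "\<bar>band_average ?a w d g n x\<bar> \<le> B / (2 * c - c\<^sup>2)"
      using divide_right_mono[OF _ less_imp_le[OF pos]] pos
      unfolding eq by (simp only: abs_divide abs_of_pos)
  qed
  fix x :: real and k :: "nat \<Rightarrow> int"
  assume x: "x \<in> {0<..<1}" and k: "(\<lambda>n. real_of_int (k n) / real n) \<longlonglongrightarrow> x"
  have kd: "(\<lambda>n. real_of_int (k n + d) / real n) \<longlonglongrightarrow> x" using k by (rule shift_ratio_tendsto)
  have "(\<lambda>n. (\<Sum>y\<in>{0..<int n}. f (k n) n y) / real n) \<longlonglongrightarrow>
     (\<integral>t. indicator {0<..<1} t * (of_bool (\<bar>x - t\<bar> < c) * G t) \<partial>lborel)"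
  proof (rule average_tendsto_integral[where B = B])
    show "\<bar>f (k n) n y\<bar> \<le> B" for n y by (rule fB)
    have "(\<lambda>t. of_bool (\<bar>x - t\<bar> < c) * (indicator {0<..<1} t * G t)) \<in> borel_measurable lborel"
      by (intro borel_measurable_times has_profile_measurable[OF g]) measurable
    then show "(\<lambda>t. indicator {0<..<1} t * (of_bool (\<bar>x - t\<bar> < c) * G t)) \<in> borel_measurable lborel"
      by (simp add: mult.left_commute)
    \<comment> \<open>The indicator jumps at distance exactly c from \<open>x\<close>, where its
      limit is undetermined; these are two points.\<close>
    show "AE t in lborel. t \<in> {0<..<1} \<longrightarrow>
        (\<lambda>n. f (k n) n \<lfloor>real n * t\<rfloor>) \<longlonglongrightarrow> of_bool (\<bar>x - t\<bar> < c) * G t"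
      using AE_lborel_singleton[of "x - c"] AE_lborel_singleton[of "x + c"]
    proof eventually_elim
      case (elim t)
      then have ne: "\<bar>x - t\<bar> \<noteq> c" by auto
      let ?r = "\<lambda>n. \<bar>k n - \<lfloor>real n * t\<rfloor> + d\<bar>"
      have "(\<lambda>n. \<bar>real_of_int (k n + d) / real n - real_of_int \<lfloor>real n * t\<rfloor> / real n\<bar>) \<longlonglongrightarrow> \<bar>x - t\<bar>"
        by (intro tendsto_intros kd floor_ratio_tendsto)
      moreover have "\<bar>real_of_int (k n + d) / real n - real_of_int \<lfloor>real n * t\<rfloor> / real n\<bar> = real_of_int (?r n) / real n" for n
        unfolding diff_divide_distrib[symmetric] abs_divide by (simp add: algebra_simps)
      ultimately have "(\<lambda>n. real_of_int (?r n) / real n) \<longlonglongrightarrow> \<bar>x - t\<bar>" by simp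
      then have diff: "(\<lambda>n. real (w n) / real n - real_of_int (?r n) / real n) \<longlonglongrightarrow> c - \<bar>x - t\<bar>"
        by (intro tendsto_diff lim_w)
      have "\<forall>\<^sub>F n in sequentially. of_bool (?r n \<le> int (w n)) = (of_bool (\<bar>x - t\<bar> < c) :: real)"
      proof (cases "\<bar>x - t\<bar> < c")
        case True
        then have "0 < c - \<bar>x - t\<bar>" by simp
        from order_tendstoD(1)[OF diff this]
        have "\<forall>\<^sub>F n in sequentially. real (w n) / real n - real_of_int (?r n) / real n > 0" .
        then show ?thesis
        proof eventually_elim
          case (elim n)
          then have "real_of_int (?r n) < real (w n)"
            unfolding diff_divide_distrib[symmetric] zero_less_divide_iff by auto
          then have "?r n \<le> int (w n)" by linarith
          with True show ?case by simp
        qed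
      next
        case False
        with ne have "c - \<bar>x - t\<bar> < 0" by simp
        from order_tendstoD(2)[OF diff this]
        have "\<forall>\<^sub>F n in sequentially. real (w n) / real n - real_of_int (?r n) / real n < 0" .
        then show ?thesis
        proof eventually_elim
          case (elim n)
          then have "real (w n) < real_of_int (?r n)"
            unfolding diff_divide_distrib[symmetric] divide_less_0_iff by auto
          then have "\<not> ?r n \<le> int (w n)" by linarith
          with False show ?case by simp
        qed
      qed
      then have "(\<lambda>n. of_bool (?r n \<le> int (w n)) :: real) \<longlonglongrightarrow> of_bool (\<bar>x - t\<bar> < c)"
        by (rule tendsto_eventually)
      then show ?case
        unfolding f_def by (intro impI tendsto_mult has_profileD[OF g _ _ floor_ratio_tendsto]) simp_all
    qed
  qed
  then show "(\<lambda>n. band_average ?a w d g n (k n)) \<longlonglongrightarrow>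
      (\<integral>t. indicator {0<..<1} t * (of_bool (\<bar>x - t\<bar> < c) * G t) \<partial>lborel) / (2 * c - c\<^sup>2)"
    unfolding eq by (intro tendsto_divide tendsto_const) (use pos in auto)
qed

text \<open>For c = 1 any two interior points of the unit interval are closer than c, so the whole
  interval is averaged and the normalizing area is 1.\<close>

lemma has_profile_full_proportion_average:
  assumes g: "has_profile g (\<lambda>_. z)" and w: "proportional_growth w 1"
  shows "has_profile (band_average (\<lambda>n. 1 / sqrt (real n)) w d g) (\<lambda>_. z)"
proof -
  have "(\<integral>t. indicator {0<..<1} t * (of_bool (\<bar>x - t\<bar> < 1) * z) \<partial>lborel) = z" if "x \<in> {0<..<1}" for x :: real
  proof -
    have "(\<integral>t. indicator {0<..<1} t * (of_bool (\<bar>x - t\<bar> < 1) * z) \<partial>lborel) =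
        (\<integral>t. indicator {0<..<1::real} t * z \<partial>lborel)"
      by (intro Bochner_Integration.integral_cong refl) (use that in \<open>auto simp: indicator_def\<close>)
    also have "\<dots> = z" by simp
    finally show ?thesis .
  qed
  with has_profile_proportional_average[OF g w, of d] show ?thesis
    by (simp add: has_profile_def)
qed

section \<open>Band sums over graphs without single edges\<close>

text \<open>\<open>Q\<close> is a class of functions of the position that is stable under leaf removal; it is used
  for the sequences with an arbitrary profile and for those with a constant profile.\<close>

locale growing_scales =
  fixes Q :: "(nat \<Rightarrow> int \<Rightarrow> real) \<Rightarrow> bool"
    and a :: "'i \<Rightarrow> nat \<Rightarrow> real" and w :: "'i \<Rightarrow> nat \<Rightarrow> nat" and Gr :: "'i set"
  assumes Q_one: "Q (\<lambda>_ _. 1)"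
    and Q_mult: "Q g \<Longrightarrow> Q h \<Longrightarrow> Q (\<lambda>n x. g n x * h n x)"
    and Q_inside: "Q (\<lambda>n x. of_bool (0 \<le> x + d \<and> x + d < int n))"
    and Q_average: "Q g \<Longrightarrow> convergent (\<lambda>n. (\<Sum>x\<in>{0..<int n}. g n x) / real n)"
    and Q_band: "i \<in> Gr \<Longrightarrow> Q g \<Longrightarrow> Q (band_average (a i) (w i) d g)"
    and a_nonneg: "i \<in> Gr \<Longrightarrow> 0 \<le> a i n"
    and a_tendsto: "i \<in> Gr \<Longrightarrow> a i \<longlonglongrightarrow> 0"
begin

lemma Q_prod: "finite A \<Longrightarrow> (\<And>v. v \<in> A \<Longrightarrow> Q (g v)) \<Longrightarrow> Q (\<lambda>n x. \<Prod>v\<in>A. g v n x)"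
  by (induction A rule: finite_induct) (simp_all add: Q_one Q_mult)

end

lemma sum_PiE_insert:
  assumes "v \<notin> R"
  shows "(\<Sum>\<psi>\<in>insert v R \<rightarrow>\<^sub>E B. f \<psi>) = (\<Sum>\<psi>\<in>R \<rightarrow>\<^sub>E B. \<Sum>y\<in>B. f (\<psi>(v := y)))"
proof -
  have "(\<Sum>\<psi>\<in>insert v R \<rightarrow>\<^sub>E B. f \<psi>) = (\<Sum>(y, \<psi>)\<in>B \<times> (R \<rightarrow>\<^sub>E B). f (\<psi>(v := y)))"
    unfolding PiE_insert_eq
    by (subst sum.reindex) (use inj_combinator[OF assms, of "\<lambda>_. B"] in \<open>auto simp: case_prod_unfold comp_def\<close>)
  also have "\<dots> = (\<Sum>\<psi>\<in>R \<rightarrow>\<^sub>E B. \<Sum>y\<in>B. f (\<psi>(v := y)))"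
    by (subst sum.swap) (simp add: sum.cartesian_product)
  finally show ?thesis .
qed

text \<open>\<open>U\<close> stands for the classes with their free positions, \<open>E\<close> for
  the growing edges, \<open>d\<close> for the differences of offsets along them. Connectedness
  appears as the existence of an edge across every cut. A twin is demanded only of edges with
  distinct ends, since diagonal entries need not be centred.\<close>

locale doubled_graph = growing_scales Q a w Gr
  for Q and a :: "'i \<Rightarrow> nat \<Rightarrow> real" and w Gr +
  fixes U E :: "nat set" and s t :: "nat \<Rightarrow> nat" and d :: "nat \<Rightarrow> int" and lab :: "nat \<Rightarrow> 'i"
  assumes finite_U: "finite U" and U_nonempty: "U \<noteq> {}" and finite_E: "finite E"
    and ends: "e \<in> E \<Longrightarrow> s e \<in> U \<and> t e \<in> U"
    and labels: "e \<in> E \<Longrightarrow> lab e \<in> Gr"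
    and crossing: "R \<subseteq> U \<Longrightarrow> R \<noteq> {} \<Longrightarrow> R \<noteq> U \<Longrightarrow>
      \<exists>e\<in>E. s e \<in> R \<and> t e \<notin> R \<or> s e \<notin> R \<and> t e \<in> R"
    and twin: "e \<in> E \<Longrightarrow> s e \<noteq> t e \<Longrightarrow>
      \<exists>e'\<in>E. e' \<noteq> e \<and> lab e' = lab e \<and>
        ((s e', t e', d e') = (s e, t e, d e) \<or> (s e', t e', d e') = (t e, s e, - d e))"
begin

definition weight :: "nat \<Rightarrow> nat \<Rightarrow> (nat \<Rightarrow> int) \<Rightarrow> real" where
  "weight e n \<psi> = a (lab e) n * of_bool (\<bar>\<psi> (s e) - \<psi> (t e) + d e\<bar> \<le> int (w (lab e) n))"

definition twins :: "nat \<Rightarrow> nat \<Rightarrow> bool" where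
  "twins e e' \<longleftrightarrow> lab e' = lab e \<and>
     ((s e', t e', d e') = (s e, t e, d e) \<or> (s e', t e', d e') = (t e, s e, - d e))"

lemma weight_twins: "twins e e' \<Longrightarrow> weight e' n \<psi> = weight e n \<psi>"
  unfolding twins_def weight_def
  by (auto simp: abs_minus_commute[of "\<psi> (t e) - \<psi> (s e)"] algebra_simps)

lemma twins_ends: "twins e e' \<Longrightarrow> {s e', t e'} = {s e, t e}"
  by (auto simp: twins_def)

lemma weight_bounds: "e \<in> E \<Longrightarrow> 0 \<le> weight e n \<psi> \<and> weight e n \<psi> \<le> a (lab e) n"
  using a_nonneg[OF labels] by (auto simp: weight_def)

text \<open>\<open>build R F\<close>: the edges \<open>F\<close> form a doubled spanning tree of the vertices \<open>R\<close>.\<close>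

inductive build :: "nat set \<Rightarrow> nat set \<Rightarrow> bool" where
  start: "r \<in> U \<Longrightarrow> build {r} {}"
| grow: "build R F \<Longrightarrow> e \<in> E \<Longrightarrow> e' \<in> E \<Longrightarrow> e \<noteq> e' \<Longrightarrow> twins e e' \<Longrightarrow> u \<in> R \<Longrightarrow> v \<in> U - R \<Longrightarrow>
    {s e, t e} = {u, v} \<Longrightarrow> build (insert v R) (insert e (insert e' F))"

lemma build_subset: "build R F \<Longrightarrow> R \<subseteq> U \<and> R \<noteq> {} \<and> F \<subseteq> E"
  by (induction rule: build.induct) auto

lemma build_ends: "build R F \<Longrightarrow> e \<in> F \<Longrightarrow> s e \<in> R \<and> t e \<in> R \<and> s e \<noteq> t e"
proof (induction rule: build.induct)
  case (grow R F e0 e' u v)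
  from twins_ends[OF grow(5)] grow have "{s e', t e'} = {u, v}" "u \<noteq> v" by auto
  with grow show ?case by (auto simp: doubleton_eq_iff)
qed simp

lemma build_new_edges:
  assumes "build R F" "twins e e'" "v \<in> U - R" "{s e, t e} = {u, v}"
  shows "e \<notin> F" "e' \<notin> F"
proof -
  have "{s e', t e'} = {u, v}" using twins_ends[OF assms(2)] assms(4) by simp
  then show "e \<notin> F" "e' \<notin> F"
    using build_ends[OF assms(1), of e] build_ends[OF assms(1), of e'] assms(3,4)
    by (auto simp: doubleton_eq_iff)
qed

text \<open>Each new vertex brings exactly two new edges. Consequently the count
  \<open>card E + 2 = 2 * card U\<close>, which recurs below, says that \<open>E\<close> is a
  doubled tree with no edge left over.\<close>

lemma build_card: "build R F \<Longrightarrow> card F + 2 = 2 * card R"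
proof (induction rule: build.induct)
  case (grow R F e e' u v)
  have "finite R" "finite F"
    using build_subset[OF grow(1)] finite_U finite_E by (auto intro: finite_subset)
  with grow build_new_edges[OF grow(1,5,7,8)] show ?case by auto
qed simp

text \<open>The two edges added last end in a vertex that no earlier edge meets, so they are twins
  of each other and of nothing older. In a doubled tree this turns the moments of growing edges into
  second moments.\<close>

lemma build_pairs: "build R F \<Longrightarrow> e \<in> F \<Longrightarrow> \<exists>e'. e' \<noteq> e \<and> {x\<in>F. twins e x} = {e, e'}"
proof (induction arbitrary: e rule: build.induct)
  case (grow R F e0 e1 u v)
  have ends1: "{s e1, t e1} = {u, v}" using twins_ends[OF grow(5)] grow(8) by simp
  have no: "\<not> twins x y \<and> \<not> twins y x" if "x \<in> F" "y \<in> {e0, e1}" for x y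
    using build_ends[OF grow(1) that(1)] twins_ends[of x y] twins_ends[of y x] that ends1 grow(7,8)
    by (auto simp: doubleton_eq_iff)
  have tw: "twins e0 e0" "twins e1 e1" "twins e1 e0" "twins e0 e1"
    using grow(5) by (auto simp: twins_def)
  show ?case
  proof (cases "e \<in> F")
    case True
    from grow.IH[OF True] no[OF True] show ?thesis by auto
  next
    case False
    then have "e = e0 \<or> e = e1" using grow.prems by auto
    then show ?thesis
    proof
      assume "e = e0"
      then show ?thesis using no tw grow(4) by (intro exI[of _ e1]) auto
    next
      assume "e = e1"
      then show ?thesis using no tw grow(4) by (intro exI[of _ e0]) auto
    qed
  qed
qed simp

text \<open>A doubled tree with the largest number of vertices spans: across a proper cut there is
  an edge, its ends differ, and it extends the tree together with its twin.\<close>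

lemma build_exists: "\<exists>F. build U F"
proof -
  let ?P = "\<lambda>m. \<exists>R F. build R F \<and> card R = m"
  obtain r where "r \<in> U" using U_nonempty by auto
  then have "?P 1" using start by fastforce
  moreover have "\<forall>m. ?P m \<longrightarrow> m \<le> card U"
    using build_subset card_mono[OF finite_U] by blast
  ultimately obtain m where m: "?P m" and max: "\<And>k. ?P k \<Longrightarrow> k \<le> m"
    using Nat.ex_has_greatest_nat[of ?P 1 "card U"] by blast
  then obtain R F where RF: "build R F" "card R = m" by auto
  have "R = U"
  proof (rule ccontr)
    assume "R \<noteq> U"
    then obtain e where e: "e \<in> E" "s e \<in> R \<and> t e \<notin> R \<or> s e \<notin> R \<and> t e \<in> R"
      using crossing build_subset[OF RF(1)] by blast
    then have "s e \<noteq> t e" by auto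
    from twin[OF e(1) this] obtain e' where "e' \<in> E" "e' \<noteq> e" "twins e e'"
      unfolding twins_def by blast
    moreover obtain u v where uv: "u \<in> R" "v \<in> U - R" "{s e, t e} = {u, v}" using e ends[of e] by blast
    ultimately have "build (insert v R) (insert e (insert e' F))"
      using grow[OF RF(1) e(1)] by blast
    then have "card (insert v R) \<le> m" using max by blast
    moreover have "finite R" using build_subset[OF RF(1)] finite_U by (auto intro: finite_subset)
    then have "card (insert v R) = Suc m" using uv RF by simp
    ultimately show False by simp
  qed
  with RF show ?thesis by auto
qed

text \<open>The vertex added last is a leaf. Summing over its position leaves a band average at its
  neighbour, which is absorbed into the function carried there; this is why the induction runs over
  arbitrary vertex functions \<open>g\<close>. Only the root remains at the end.\<close>

lemma build_sum:
  assumes "build R F" "\<And>v. v \<in> R \<Longrightarrow> Q (g v)"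
  shows "\<exists>q. Q q \<and> (\<forall>n. (\<Sum>\<psi>\<in>R \<rightarrow>\<^sub>E {0..<int n}. (\<Prod>e\<in>F. weight e n \<psi>) * (\<Prod>v\<in>R. g v n (\<psi> v))) =
    (\<Sum>x\<in>{0..<int n}. q n x))"
  using assms
proof (induction arbitrary: g rule: build.induct)
  case (start r)
  have "(\<Sum>\<psi>\<in>{r} \<rightarrow>\<^sub>E {0..<int n}. (\<Prod>e\<in>{}. weight e n \<psi>) * (\<Prod>v\<in>{r}. g v n (\<psi> v))) =
    (\<Sum>x\<in>{0..<int n}. g r n x)" for n
    by (subst sum_PiE_insert) auto
  with start show ?case by auto
next
  case (grow R F e e' u v)
  note new = build_new_edges[OF grow(1,5,7,8)]
  have fin: "finite R" "finite F"
    using build_subset[OF grow(1)] finite_U finite_E by (auto intro: finite_subset)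
  have v: "v \<notin> R" and uR: "u \<in> R" "u \<noteq> v" using grow by auto
  \<comment> \<open>The sign makes the displacement read from the neighbour \<open>u\<close> to the
    leaf, whatever the direction of \<open>e\<close>.\<close>
  define \<delta> where "\<delta> = (if s e = u then d e else - d e)"
  define h where "h = band_average (a (lab e)) (w (lab e)) \<delta> (g v)"
  define g' where "g' = g(u := (\<lambda>n x. g u n x * h n x))"
  have Qh: "Q h" unfolding h_def using grow labels by (intro Q_band) auto
  have "Q (g' x)" if "x \<in> R" for x
    using that grow.prems Qh uR by (auto simp: g'_def intro!: Q_mult)
  then obtain q where q: "Q q" and qs: "\<And>n. (\<Sum>\<psi>\<in>R \<rightarrow>\<^sub>E {0..<int n}. (\<Prod>e\<in>F. weight e n \<psi>) * (\<Prod>v\<in>R. g' v n (\<psi> v))) =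
    (\<Sum>x\<in>{0..<int n}. q n x)" using grow.IH[of g'] by blast
  have "(\<Sum>\<psi>\<in>insert v R \<rightarrow>\<^sub>E {0..<int n}. (\<Prod>e\<in>insert e (insert e' F). weight e n \<psi>) * (\<Prod>v\<in>insert v R. g v n (\<psi> v))) =
    (\<Sum>\<psi>\<in>R \<rightarrow>\<^sub>E {0..<int n}. (\<Prod>e\<in>F. weight e n \<psi>) * (\<Prod>v\<in>R. g' v n (\<psi> v)))" for n
    unfolding sum_PiE_insert[OF v]
  proof (intro sum.cong refl)
    fix \<psi>
    have F: "(\<Prod>f\<in>F. weight f n (\<psi>(v := y))) = (\<Prod>f\<in>F. weight f n \<psi>)" for y
      using build_ends[OF grow(1)] v by (intro prod.cong refl) (auto simp: weight_def)
    have R: "(\<Prod>x\<in>insert v R. g x n ((\<psi>(v := y)) x)) = g v n y * (\<Prod>x\<in>R. g x n (\<psi> x))" for y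
      unfolding prod.insert[OF fin(1) v] using v by (intro arg_cong2[where f = "(*)"] prod.cong refl) auto
    have G': "(\<Prod>x\<in>R. g' x n (\<psi> x)) = (\<Prod>x\<in>R. g x n (\<psi> x)) * h n (\<psi> u)"
      using fin uR by (simp add: g'_def prod.remove[of R u] algebra_simps)
    have ee: "weight e n (\<psi>(v := y)) * weight e' n (\<psi>(v := y)) =
        (a (lab e) n)\<^sup>2 * of_bool (\<bar>\<psi> u - y + \<delta>\<bar> \<le> int (w (lab e) n))" for y
    proof -
      have "\<bar>(\<psi>(v := y)) (s e) - (\<psi>(v := y)) (t e) + d e\<bar> = \<bar>\<psi> u - y + \<delta>\<bar>"
      proof (cases "s e = u")
        case True
        with grow(8) uR show ?thesis by (simp add: doubleton_eq_iff \<delta>_def)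
      next
        case False
        with grow(8) uR have "s e = v" "t e = u" by (auto simp: doubleton_eq_iff)
        with False uR show ?thesis by (simp add: \<delta>_def)
      qed
      then show ?thesis
        unfolding weight_twins[OF grow(5)] by (simp add: weight_def power2_eq_square)
    qed
    have "(\<Prod>f\<in>insert e (insert e' F). weight f n (\<psi>(v := y))) * (\<Prod>x\<in>insert v R. g x n ((\<psi>(v := y)) x)) =
        (\<Prod>f\<in>F. weight f n \<psi>) * (\<Prod>x\<in>R. g x n (\<psi> x)) *
        ((a (lab e) n)\<^sup>2 * of_bool (\<bar>\<psi> u - y + \<delta>\<bar> \<le> int (w (lab e) n)) * g v n y)" for y
      unfolding R ee[symmetric] using new grow(4) fin by (simp add: F mult_ac)
    then show "(\<Sum>y\<in>{0..<int n}. (\<Prod>f\<in>insert e (insert e' F). weight f n (\<psi>(v := y))) *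
        (\<Prod>x\<in>insert v R. g x n ((\<psi>(v := y)) x))) =
        (\<Prod>f\<in>F. weight f n \<psi>) * (\<Prod>x\<in>R. g' x n (\<psi> x))"
      by (simp add: G' h_def band_average_def sum_distrib_left mult.assoc)
  qed
  with q qs show ?case by auto
qed

definition graph_sum :: "(nat \<Rightarrow> nat \<Rightarrow> int \<Rightarrow> real) \<Rightarrow> nat \<Rightarrow> real" where
  "graph_sum g n = (\<Sum>\<psi>\<in>U \<rightarrow>\<^sub>E {0..<int n}. (\<Prod>e\<in>E. weight e n \<psi>) * (\<Prod>v\<in>U. g v n (\<psi> v))) / real n"

lemma tree_edges:
  assumes "card E + 2 = 2 * card U" "build U F"
  shows "F = E"
proof -
  have "card F = card E" using assms(1) build_card[OF assms(2)] by linarith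
  with card_subset_eq[OF finite_E] build_subset[OF assms(2)] show ?thesis by blast
qed

lemma graph_sum_convergent:
  assumes "card E + 2 = 2 * card U" "\<And>v. v \<in> U \<Longrightarrow> Q (g v)"
  shows "convergent (graph_sum g)"
proof -
  obtain F where F: "build U F" using build_exists by blast
  with assms(1) have "build U E" using tree_edges by blast
  then obtain q where "Q q" and
    "\<forall>n. (\<Sum>\<psi>\<in>U \<rightarrow>\<^sub>E {0..<int n}. (\<Prod>e\<in>E. weight e n \<psi>) * (\<Prod>v\<in>U. g v n (\<psi> v))) = (\<Sum>x\<in>{0..<int n}. q n x)"
    using build_sum[of U E g] assms(2) by blast
  with Q_average[of q] show ?thesis by (simp add: graph_sum_def[abs_def])
qed

lemma tree_pairs:
  assumes "card E + 2 = 2 * card U" "e \<in> E"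
  shows "s e \<noteq> t e" "\<exists>e'. e' \<noteq> e \<and> {x\<in>E. twins e x} = {e, e'}"
proof -
  obtain F where F: "build U F" using build_exists by blast
  with assms(1) have "build U E" using tree_edges by blast
  with build_ends[OF this assms(2)] build_pairs[OF this assms(2)]
  show "s e \<noteq> t e" "\<exists>e'. e' \<noteq> e \<and> {x\<in>E. twins e x} = {e, e'}" by auto
qed

text \<open>Edges outside a doubled spanning tree are bounded by their scale, forgetting their band
  condition. Nonnegative vertex functions preserve this bound under multiplication, and the tree
  itself has a convergent, hence bounded, sum.\<close>

lemma graph_sum_vanishes:
  assumes "card E + 2 \<noteq> 2 * card U" "\<And>v. v \<in> U \<Longrightarrow> Q (g v)" "\<And>v n x. 0 \<le> g v n x"
  shows "graph_sum g \<longlonglongrightarrow> 0"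
proof -
  obtain F where F: "build U F" using build_exists by blast
  obtain q where q: "Q q" and
    qs: "\<And>n. (\<Sum>\<psi>\<in>U \<rightarrow>\<^sub>E {0..<int n}. (\<Prod>e\<in>F. weight e n \<psi>) * (\<Prod>v\<in>U. g v n (\<psi> v))) = (\<Sum>x\<in>{0..<int n}. q n x)"
    using build_sum[OF F, of g] assms(2) by blast
  have FE: "F \<subseteq> E" using build_subset[OF F] by simp
  moreover have "F \<noteq> E" using build_card[OF F] assms(1) by auto
  ultimately have "E - F \<noteq> {}" by blast
  have fin: "finite F" "finite (E - F)" using FE finite_E finite_subset by auto
  have le: "graph_sum g n \<le> (\<Prod>e\<in>E - F. a (lab e) n) * ((\<Sum>x\<in>{0..<int n}. q n x) / real n)" for n
  proof -
    have "(\<Prod>e\<in>E. weight e n \<psi>) * (\<Prod>v\<in>U. g v n (\<psi> v)) \<le>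
        (\<Prod>e\<in>E - F. a (lab e) n) * ((\<Prod>e\<in>F. weight e n \<psi>) * (\<Prod>v\<in>U. g v n (\<psi> v)))" for \<psi>
    proof -
      have "(\<Prod>e\<in>E. weight e n \<psi>) = (\<Prod>e\<in>E - F. weight e n \<psi>) * (\<Prod>e\<in>F. weight e n \<psi>)"
        by (rule prod.subset_diff[OF FE finite_E])
      also have "\<dots> \<le> (\<Prod>e\<in>E - F. a (lab e) n) * (\<Prod>e\<in>F. weight e n \<psi>)"
        by (intro mult_right_mono prod_mono prod_nonneg) (use weight_bounds FE in blast)+
      finally show ?thesis
        unfolding mult.assoc[symmetric] by (intro mult_right_mono prod_nonneg) (use assms(3) in auto)
    qed
    then show ?thesis
      unfolding graph_sum_def qs[symmetric] times_divide_eq_right sum_distrib_left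
      by (intro divide_right_mono sum_mono) auto
  qed
  have ge: "0 \<le> graph_sum g n" for n
    unfolding graph_sum_def
    by (intro divide_nonneg_nonneg sum_nonneg mult_nonneg_nonneg prod_nonneg)
      (use weight_bounds assms(3) in auto)
  have "(\<lambda>n. \<Prod>e\<in>E - F. a (lab e) n) \<longlonglongrightarrow> (\<Prod>e\<in>E - F. 0)"
    by (intro tendsto_prod a_tendsto labels) auto
  moreover have "(\<Prod>e\<in>E - F. 0::real) = 0" 
    by (rule prod_zero[OF fin(2)]) (use \<open>E - F \<noteq> {}\<close> in blast)
  ultimately have prod0: "(\<lambda>n. \<Prod>e\<in>E - F. a (lab e) n) \<longlonglongrightarrow> 0" by (simp only:)
  obtain l where "(\<lambda>n. (\<Sum>x\<in>{0..<int n}. q n x) / real n) \<longlonglongrightarrow> l"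
    using Q_average[OF q] by (auto simp: convergent_def)
  from tendsto_mult[OF prod0 this] have
    "(\<lambda>n. (\<Prod>e\<in>E - F. a (lab e) n) * ((\<Sum>x\<in>{0..<int n}. q n x) / real n)) \<longlonglongrightarrow> 0" by simp
  then show ?thesis
    by (rule tendsto_sandwich[OF always_eventually[OF allI[OF ge]] always_eventually[OF allI[OF le]] tendsto_const])
qed

end

section \<open>Maps with prescribed relative positions\<close>

lemma sum_UN_le:
  fixes f :: "'a \<Rightarrow> real"
  assumes "finite I" "\<And>i. finite (B i)" "\<And>x. 0 \<le> f x"
  shows "sum f (\<Union>i\<in>I. B i) \<le> (\<Sum>i\<in>I. sum f (B i))"
  using assms(1)
proof (induction I rule: finite_induct)
  case (insert i I)
  have "sum f (B i \<union> (\<Union>i\<in>I. B i)) + sum f (B i \<inter> (\<Union>i\<in>I. B i)) = sum f (B i) + sum f (\<Union>i\<in>I. B i)"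
    by (rule sum.union_inter) (use assms(2) insert in auto)
  moreover have "0 \<le> sum f (B i \<inter> (\<Union>i\<in>I. B i))" by (intro sum_nonneg assms(3))
  ultimately show ?case using insert by simp
qed simp

definition edge_weight where
  "edge_weight a w tar src lab e n \<phi> =
     (a (lab e) n :: real) * of_bool (\<bar>\<phi> (tar e) - \<phi> (src e)\<bar> \<le> int (w (lab e) n))"

text \<open>\<open>cls\<close> selects a representative of each class and \<open>off\<close> gives
  the displacement from it, so such a map is determined by its values at the
  representatives.\<close>

definition rigid_maps :: "nat set \<Rightarrow> (nat \<Rightarrow> nat) \<Rightarrow> (nat \<Rightarrow> int) \<Rightarrow> nat \<Rightarrow> (nat \<Rightarrow> int) set" where
  "rigid_maps V cls off n = {\<phi> \<in> V \<rightarrow>\<^sub>E {0..<int n}. \<forall>v\<in>V. \<phi> v = \<phi> (cls v) + off v}"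

lemma finite_rigid_maps: "finite V \<Longrightarrow> finite (rigid_maps V cls off n)"
  by (simp add: rigid_maps_def finite_PiE)

text \<open>\<open>class_crossing\<close> is connectedness after contraction of the classes,
  expressed through sets that are unions of classes. \<open>class_twin\<close> describes the ends by
  class and offset, data that a merging of classes transforms consistently.\<close>

locale rigid_classes = growing_scales Q a w Gr
  for Q and a :: "'i \<Rightarrow> nat \<Rightarrow> real" and w Gr +
  fixes V Eg :: "nat set" and tar src :: "nat \<Rightarrow> nat" and lab :: "nat \<Rightarrow> 'i"
    and cls :: "nat \<Rightarrow> nat" and off :: "nat \<Rightarrow> int"
  assumes finite_V: "finite V" and V_nonempty: "V \<noteq> {}" and finite_Eg: "finite Eg"
    and tar_src: "e \<in> Eg \<Longrightarrow> tar e \<in> V \<and> src e \<in> V"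
    and lab_Gr: "e \<in> Eg \<Longrightarrow> lab e \<in> Gr"
    and cls_V: "v \<in> V \<Longrightarrow> cls v \<in> V" and cls_cls: "v \<in> V \<Longrightarrow> cls (cls v) = cls v"
    and off_cls: "v \<in> V \<Longrightarrow> off (cls v) = 0"
    and class_crossing: "R \<subseteq> V \<Longrightarrow> R \<noteq> {} \<Longrightarrow> R \<noteq> V \<Longrightarrow>
      (\<And>u v. u \<in> V \<Longrightarrow> v \<in> V \<Longrightarrow> cls u = cls v \<Longrightarrow> u \<in> R \<Longrightarrow> v \<in> R) \<Longrightarrow>
      \<exists>e\<in>Eg. tar e \<in> R \<and> src e \<notin> R \<or> tar e \<notin> R \<and> src e \<in> R"
    and class_twin: "e \<in> Eg \<Longrightarrow> cls (tar e) \<noteq> cls (src e) \<Longrightarrow>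
      \<exists>e'\<in>Eg. e' \<noteq> e \<and> lab e' = lab e \<and>
        ((cls (tar e'), off (tar e'), cls (src e'), off (src e')) = (cls (tar e), off (tar e), cls (src e), off (src e)) \<or>
         (cls (tar e'), off (tar e'), cls (src e'), off (src e')) = (cls (src e), off (src e), cls (tar e), off (tar e)))"
begin

sublocale G: doubled_graph Q a w Gr "cls ` V" Eg "\<lambda>e. cls (tar e)" "\<lambda>e. cls (src e)"
  "\<lambda>e. off (tar e) - off (src e)" lab
proof unfold_locales
  fix R assume R: "R \<subseteq> cls ` V" "R \<noteq> {}" "R \<noteq> cls ` V"
  let ?R = "{v \<in> V. cls v \<in> R}"
  have "\<exists>e\<in>Eg. tar e \<in> ?R \<and> src e \<notin> ?R \<or> tar e \<notin> ?R \<and> src e \<in> ?R"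
    by (rule class_crossing) (use R in auto)
  then show "\<exists>e\<in>Eg. cls (tar e) \<in> R \<and> cls (src e) \<notin> R \<or> cls (tar e) \<notin> R \<and> cls (src e) \<in> R"
    using tar_src by auto
next
  fix e assume "e \<in> Eg" "cls (tar e) \<noteq> cls (src e)"
  from class_twin[OF this] show "\<exists>e'\<in>Eg. e' \<noteq> e \<and> lab e' = lab e \<and>
     ((cls (tar e'), cls (src e'), off (tar e') - off (src e')) = (cls (tar e), cls (src e), off (tar e) - off (src e)) \<or>
      (cls (tar e'), cls (src e'), off (tar e') - off (src e')) = (cls (src e), cls (tar e), - (off (tar e) - off (src e))))"
    by (elim bexE) (rule bexI, auto)
qed (use finite_V V_nonempty finite_Eg tar_src lab_Gr in auto)

definition class_sum :: "nat \<Rightarrow> real" where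
  "class_sum n = (\<Sum>\<phi>\<in>rigid_maps V cls off n. \<Prod>e\<in>Eg. edge_weight a w tar src lab e n \<phi>) / real n"

text \<open>Placing a representative at \<open>x\<close> puts the other members of its class at
  \<open>x + off v\<close>, possibly out of range. This factor restores the range condition when
  representatives are summed freely.\<close>

definition inside :: "nat \<Rightarrow> nat \<Rightarrow> int \<Rightarrow> real" where
  "inside A n x = (\<Prod>v\<in>{v \<in> V. cls v = A}. of_bool (0 \<le> x + off v \<and> x + off v < int n))"

lemma prod_inside:
  "(\<Prod>A\<in>cls ` V. inside A n (\<psi> A)) = of_bool (\<forall>v\<in>V. \<psi> (cls v) + off v \<in> {0..<int n})"
proof -
  have "(\<Prod>A\<in>cls ` V. inside A n (\<psi> A)) =
      (\<Prod>A\<in>cls ` V. \<Prod>v\<in>{v \<in> V. cls v = A}. of_bool (\<psi> (cls v) + off v \<in> {0..<int n}))"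
    unfolding inside_def by (intro prod.cong refl) auto
  also have "\<dots> = (\<Prod>v\<in>V. of_bool (\<psi> (cls v) + off v \<in> {0..<int n}))"
    using finite_V by (rule prod.image_gen[symmetric])
  also have "\<dots> = of_bool (\<forall>v\<in>V. \<psi> (cls v) + off v \<in> {0..<int n})"
    using finite_V by (induction V rule: finite_induct) auto
  finally show ?thesis .
qed

lemma class_sum_eq_graph_sum: "class_sum n = G.graph_sum inside n"
proof -
  let ?good = "{\<psi> \<in> cls ` V \<rightarrow>\<^sub>E {0..<int n}. \<forall>v\<in>V. \<psi> (cls v) + off v \<in> {0..<int n}}"
  have fin: "finite (cls ` V \<rightarrow>\<^sub>E {0..<int n})" using finite_V by (simp add: finite_PiE)
  have "(\<Sum>\<psi>\<in>cls ` V \<rightarrow>\<^sub>E {0..<int n}. (\<Prod>e\<in>Eg. G.weight e n \<psi>) * (\<Prod>A\<in>cls ` V. inside A n (\<psi> A))) =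
      (\<Sum>\<psi>\<in>?good. \<Prod>e\<in>Eg. G.weight e n \<psi>)"
    unfolding prod_inside using fin by (intro sum.mono_neutral_cong_right) auto
  also have "\<dots> = (\<Sum>\<phi>\<in>rigid_maps V cls off n. \<Prod>e\<in>Eg. edge_weight a w tar src lab e n \<phi>)"
  proof (rule sum.reindex_bij_witness[where
        i = "\<lambda>\<phi>. restrict \<phi> (cls ` V)" and j = "\<lambda>\<psi>. \<lambda>v\<in>V. \<psi> (cls v) + off v"])
    fix \<psi> assume \<psi>: "\<psi> \<in> ?good"
    have *: "(\<lambda>v\<in>V. \<psi> (cls v) + off v) (cls v) = \<psi> (cls v)" if "v \<in> V" for v
      using that by (simp add: cls_V cls_cls off_cls)
    show "restrict (\<lambda>v\<in>V. \<psi> (cls v) + off v) (cls ` V) = \<psi>"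
    proof
      fix x show "restrict (\<lambda>v\<in>V. \<psi> (cls v) + off v) (cls ` V) x = \<psi> x"
      proof (cases "x \<in> cls ` V")
        case True
        then obtain v where "v \<in> V" "x = cls v" by auto
        with *[of v] True show ?thesis by (simp only: restrict_apply) (simp split: if_splits)
      next
        case False
        with \<psi> show ?thesis by (auto simp: PiE_def extensional_def)
      qed
    qed
    show "(\<lambda>v\<in>V. \<psi> (cls v) + off v) \<in> rigid_maps V cls off n"
      unfolding rigid_maps_def using \<psi> * by auto
    show "(\<Prod>e\<in>Eg. edge_weight a w tar src lab e n (\<lambda>v\<in>V. \<psi> (cls v) + off v)) = (\<Prod>e\<in>Eg. G.weight e n \<psi>)"
      by (intro prod.cong refl) (use tar_src in \<open>auto simp: edge_weight_def G.weight_def algebra_simps\<close>)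
  next
    fix \<phi> assume \<phi>: "\<phi> \<in> rigid_maps V cls off n"
    then have eq: "\<And>v. v \<in> V \<Longrightarrow> \<phi> (cls v) + off v = \<phi> v" and \<phi>1: "\<phi> \<in> V \<rightarrow>\<^sub>E {0..<int n}"
      by (auto simp: rigid_maps_def)
    show "(\<lambda>v\<in>V. restrict \<phi> (cls ` V) (cls v) + off v) = \<phi>"
    proof
      fix x show "(\<lambda>v\<in>V. restrict \<phi> (cls ` V) (cls v) + off v) x = \<phi> x"
        using \<phi>1 eq by (cases "x \<in> V") (auto simp: PiE_def extensional_def)
    qed
    show "restrict \<phi> (cls ` V) \<in> ?good"
      using \<phi>1 eq cls_V by (auto simp: PiE_def Pi_def)
  qed
  finally show ?thesis by (simp add: class_sum_def G.graph_sum_def)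
qed

lemma Q_inside_class: "Q (inside A)"
  unfolding inside_def[abs_def] using finite_V by (intro Q_prod Q_inside) auto

lemma class_sum_convergent: "card Eg + 2 = 2 * card (cls ` V) \<Longrightarrow> convergent class_sum"
  unfolding class_sum_eq_graph_sum[abs_def] by (rule G.graph_sum_convergent[OF _ Q_inside_class])

lemma class_sum_vanishes: "card Eg + 2 \<noteq> 2 * card (cls ` V) \<Longrightarrow> class_sum \<longlonglongrightarrow> 0"
  unfolding class_sum_eq_graph_sum[abs_def]
  by (rule G.graph_sum_vanishes[OF _ Q_inside_class]) (auto simp: inside_def intro!: prod_nonneg)

lemma edge_weight_prod_nonneg: "0 \<le> (\<Prod>e\<in>Eg. edge_weight a w tar src lab e n \<phi>)"
  by (intro prod_nonneg) (use a_nonneg lab_Gr in \<open>auto simp: edge_weight_def\<close>)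

text \<open>Imposing the difference \<delta> between \<open>p\<close> and \<open>q\<close> glues the
  class of \<open>p\<close> rigidly to that of \<open>q\<close>. The shift
  \<open>\<delta> + off q - off p\<close> comes from solving for the displacement of a member of the
  first class from the representative of the second.\<close>

lemma merged_classes:
  fixes \<delta> :: int
  assumes p: "p \<in> V" "q \<in> V" "cls p \<noteq> cls q"
  defines "cls' \<equiv> \<lambda>v. if cls v = cls p then cls q else cls v"
    and "off' \<equiv> \<lambda>v. if cls v = cls p then off v + (\<delta> + off q - off p) else off v"
  shows "rigid_classes Q a w Gr V Eg tar src lab cls' off'"
    and "card (cls' ` V) < card (cls ` V)"
    and "\<phi> \<in> rigid_maps V cls off n \<Longrightarrow> \<phi> p - \<phi> q = \<delta> \<Longrightarrow> \<phi> \<in> rigid_maps V cls' off' n"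
proof -
  have cong: "cls' x = cls' y \<and> off' x = off' y" if "cls x = cls y" "off x = off y" for x y
    using that by (simp add: cls'_def off'_def)
  show "rigid_classes Q a w Gr V Eg tar src lab cls' off'"
  proof unfold_locales
    fix R assume R: "R \<subseteq> V" "R \<noteq> {}" "R \<noteq> V"
      "\<And>u v. u \<in> V \<Longrightarrow> v \<in> V \<Longrightarrow> cls' u = cls' v \<Longrightarrow> u \<in> R \<Longrightarrow> v \<in> R"
    show "\<exists>e\<in>Eg. tar e \<in> R \<and> src e \<notin> R \<or> tar e \<notin> R \<and> src e \<in> R"
    proof (rule class_crossing[OF R(1-3)])
      fix u v assume "u \<in> V" "v \<in> V" "cls u = cls v" "u \<in> R"
      with R(4)[of u v] show "v \<in> R" by (simp add: cls'_def)
    qed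
  next
    fix e assume e: "e \<in> Eg" "cls' (tar e) \<noteq> cls' (src e)"
    then have "cls (tar e) \<noteq> cls (src e)" unfolding cls'_def by metis
    from class_twin[OF e(1) this] obtain e' where "e' \<in> Eg" "e' \<noteq> e" "lab e' = lab e"
      "(cls (tar e'), off (tar e'), cls (src e'), off (src e')) = (cls (tar e), off (tar e), cls (src e), off (src e)) \<or>
       (cls (tar e'), off (tar e'), cls (src e'), off (src e')) = (cls (src e), off (src e), cls (tar e), off (tar e))"
      by blast
    then show "\<exists>e'\<in>Eg. e' \<noteq> e \<and> lab e' = lab e \<and>
        ((cls' (tar e'), off' (tar e'), cls' (src e'), off' (src e')) = (cls' (tar e), off' (tar e), cls' (src e), off' (src e)) \<or>
         (cls' (tar e'), off' (tar e'), cls' (src e'), off' (src e')) = (cls' (src e), off' (src e), cls' (tar e), off' (tar e)))"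
      using cong[of "tar e'" "tar e"] cong[of "src e'" "src e"] cong[of "tar e'" "src e"] cong[of "src e'" "tar e"]
      by (intro bexI[of _ e']) auto
  next
    fix v assume v: "v \<in> V"
    show "cls' v \<in> V" "cls' (cls' v) = cls' v" "off' (cls' v) = 0"
      using v p by (simp_all add: cls'_def off'_def cls_V cls_cls off_cls)
  qed (use finite_V V_nonempty finite_Eg tar_src lab_Gr in auto)
  have "cls' ` V \<subseteq> cls ` V - {cls p}" using p by (auto simp: cls'_def)
  then have "cls' ` V \<subset> cls ` V" using p by blast
  then show "card (cls' ` V) < card (cls ` V)" using finite_V by (intro psubset_card_mono) auto
  assume \<phi>: "\<phi> \<in> rigid_maps V cls off n" "\<phi> p - \<phi> q = \<delta>"
  then have "\<And>v. v \<in> V \<Longrightarrow> \<phi> v = \<phi> (cls v) + off v" by (auto simp: rigid_maps_def)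
  from this[of p] this[of q] \<phi> p show "\<phi> \<in> rigid_maps V cls' off' n"
    by (auto simp: rigid_maps_def cls'_def off'_def)
qed

text \<open>A coincidence between two classes lowers the number of classes but keeps all edges, so
  there are now more edges than a doubled tree has and the sum vanishes in the limit.\<close>

lemma rare_coincidence:
  assumes tree: "card Eg + 2 = 2 * card (cls ` V)"
    and p: "p \<in> V" "q \<in> V" "cls p \<noteq> cls q"
  shows "(\<lambda>n. (\<Sum>\<phi>\<in>{\<phi> \<in> rigid_maps V cls off n. \<phi> p - \<phi> q = \<delta>}.
    \<Prod>e\<in>Eg. edge_weight a w tar src lab e n \<phi>) / real n) \<longlonglongrightarrow> 0"
proof -
  define cls' where "cls' = (\<lambda>v. if cls v = cls p then cls q else cls v)"
  define off' where "off' = (\<lambda>v. if cls v = cls p then off v + (\<delta> + off q - off p) else off v)"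
  note merged = merged_classes(1)[OF p, of \<delta>, folded cls'_def off'_def]
    merged_classes(2)[OF p, folded cls'_def]
    merged_classes(3)[OF p, where \<delta> = \<delta>, folded cls'_def off'_def]
  interpret M: rigid_classes Q a w Gr V Eg tar src lab cls' off' by (rule merged(1))
  have "M.class_sum \<longlonglongrightarrow> 0"
    by (rule M.class_sum_vanishes) (use merged(2) tree in linarith)
  then show ?thesis
  proof (rule tendsto_sandwich[OF always_eventually always_eventually tendsto_const, rotated 2])
    show "\<forall>n. 0 \<le> (\<Sum>\<phi>\<in>{\<phi> \<in> rigid_maps V cls off n. \<phi> p - \<phi> q = \<delta>}.
        \<Prod>e\<in>Eg. edge_weight a w tar src lab e n \<phi>) / real n"
      by (intro allI divide_nonneg_nonneg sum_nonneg edge_weight_prod_nonneg) auto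
    show "\<forall>n. (\<Sum>\<phi>\<in>{\<phi> \<in> rigid_maps V cls off n. \<phi> p - \<phi> q = \<delta>}.
        \<Prod>e\<in>Eg. edge_weight a w tar src lab e n \<phi>) / real n \<le> M.class_sum n"
      unfolding M.class_sum_def
      by (intro allI divide_right_mono sum_mono2 finite_rigid_maps finite_V edge_weight_prod_nonneg)
        (use merged(3) in auto)
  qed
qed

end

text \<open>When \<open>D\<close> is at least every fixed band width, the pattern decides which positions coincide, which
  edges of fixed band width are present, and the order of their ends.\<close>

definition pattern :: "nat set \<Rightarrow> nat \<Rightarrow> (nat \<Rightarrow> int) \<Rightarrow> (nat \<times> nat \<times> int) set" where
  "pattern V D \<phi> = {(u, v, \<delta>). u \<in> V \<and> v \<in> V \<and> \<delta> = \<phi> u - \<phi> v \<and> \<bar>\<delta>\<bar> \<le> int D}"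

lemma pattern_subset: "pattern V D \<phi> \<subseteq> V \<times> V \<times> {- int D..int D}"
  by (auto simp: pattern_def)

lemma pattern_eqD:
  assumes "pattern V D \<phi> = pattern V D \<phi>\<^sub>0" "u \<in> V" "v \<in> V"
  shows "\<bar>\<phi> u - \<phi> v\<bar> \<le> int D \<longleftrightarrow> \<bar>\<phi>\<^sub>0 u - \<phi>\<^sub>0 v\<bar> \<le> int D"
    and "\<bar>\<phi>\<^sub>0 u - \<phi>\<^sub>0 v\<bar> \<le> int D \<Longrightarrow> \<phi> u - \<phi> v = \<phi>\<^sub>0 u - \<phi>\<^sub>0 v"
proof -
  have "(u, v, \<delta>) \<in> pattern V D \<phi> \<longleftrightarrow> (u, v, \<delta>) \<in> pattern V D \<phi>\<^sub>0" for \<delta> using assms(1) by simp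
  then have *: "\<delta> = \<phi> u - \<phi> v \<and> \<bar>\<delta>\<bar> \<le> int D \<longleftrightarrow> \<delta> = \<phi>\<^sub>0 u - \<phi>\<^sub>0 v \<and> \<bar>\<delta>\<bar> \<le> int D" for \<delta>
    using assms(2,3) by (simp add: pattern_def)
  show "\<bar>\<phi> u - \<phi> v\<bar> \<le> int D \<longleftrightarrow> \<bar>\<phi>\<^sub>0 u - \<phi>\<^sub>0 v\<bar> \<le> int D"
    using *[of "\<phi> u - \<phi> v"] *[of "\<phi>\<^sub>0 u - \<phi>\<^sub>0 v"] by auto
  show "\<phi> u - \<phi> v = \<phi>\<^sub>0 u - \<phi>\<^sub>0 v" if "\<bar>\<phi>\<^sub>0 u - \<phi>\<^sub>0 v\<bar> \<le> int D"
    using *[of "\<phi>\<^sub>0 u - \<phi>\<^sub>0 v"] that by auto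
qed

text \<open>\<open>\<phi>\<^sub>0\<close> represents its pattern. A vertex set that is farther than
  \<open>D\<close> from its complement cannot be left along an edge of fixed width, so a growing
  edge must leave it: this is \<open>pattern_crossing\<close>. \<open>pattern_twin\<close> is what
  centring of the entries leaves over.\<close>

locale close_pattern = growing_scales Q a w Gr
  for Q and a :: "'i \<Rightarrow> nat \<Rightarrow> real" and w Gr +
  fixes V Eg :: "nat set" and tar src :: "nat \<Rightarrow> nat" and lab :: "nat \<Rightarrow> 'i"
    and D :: nat and \<phi>\<^sub>0 :: "nat \<Rightarrow> int"
  assumes finite_V: "finite V" and V_nonempty: "V \<noteq> {}" and finite_Eg: "finite Eg"
    and tar_src: "e \<in> Eg \<Longrightarrow> tar e \<in> V \<and> src e \<in> V"
    and lab_Gr: "e \<in> Eg \<Longrightarrow> lab e \<in> Gr"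
    and pattern_crossing: "R \<subseteq> V \<Longrightarrow> R \<noteq> {} \<Longrightarrow> R \<noteq> V \<Longrightarrow>
      (\<And>u v. u \<in> R \<Longrightarrow> v \<in> V - R \<Longrightarrow> \<bar>\<phi>\<^sub>0 u - \<phi>\<^sub>0 v\<bar> > int D) \<Longrightarrow>
      \<exists>e\<in>Eg. tar e \<in> R \<and> src e \<notin> R \<or> tar e \<notin> R \<and> src e \<in> R"
    and pattern_twin: "e \<in> Eg \<Longrightarrow> \<phi>\<^sub>0 (tar e) \<noteq> \<phi>\<^sub>0 (src e) \<Longrightarrow>
      \<exists>e'\<in>Eg. e' \<noteq> e \<and> lab e' = lab e \<and> {\<phi>\<^sub>0 (tar e'), \<phi>\<^sub>0 (src e')} = {\<phi>\<^sub>0 (tar e), \<phi>\<^sub>0 (src e)}"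
begin

text \<open>Closeness is not transitive, hence the closure. The pattern fixes each difference along
  a chain of close vertices, and thereby also differences larger than \<open>D\<close> between its
  ends.\<close>

definition linked :: "nat \<Rightarrow> nat \<Rightarrow> bool" where
  "linked u v \<longleftrightarrow> (u, v) \<in> {(u, v). u \<in> V \<and> v \<in> V \<and> \<bar>\<phi>\<^sub>0 u - \<phi>\<^sub>0 v\<bar> \<le> int D}\<^sup>+"

definition cls :: "nat \<Rightarrow> nat" where "cls v = (LEAST u. linked v u)"
definition off :: "nat \<Rightarrow> int" where "off v = \<phi>\<^sub>0 v - \<phi>\<^sub>0 (cls v)"

lemma linked_close: "u \<in> V \<Longrightarrow> v \<in> V \<Longrightarrow> \<bar>\<phi>\<^sub>0 u - \<phi>\<^sub>0 v\<bar> \<le> int D \<Longrightarrow> linked u v"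
  unfolding linked_def by (rule r_into_trancl) simp

lemma linked_V: "linked u v \<Longrightarrow> u \<in> V \<and> v \<in> V"
  unfolding linked_def by (induction rule: trancl_induct) auto

lemma linked_refl: "v \<in> V \<Longrightarrow> linked v v"
  by (rule linked_close) auto

lemma linked_trans: "linked u v \<Longrightarrow> linked v x \<Longrightarrow> linked u x"
  unfolding linked_def by (rule trancl_trans)

lemma linked_sym: "linked u v \<Longrightarrow> linked v u"
  unfolding linked_def
  by (rule symD[OF sym_trancl]) (auto intro!: symI simp: abs_minus_commute)

lemma linked_cls: "v \<in> V \<Longrightarrow> linked v (cls v)"
  unfolding cls_def by (rule LeastI) (rule linked_refl)

lemma cls_eq_iff: "u \<in> V \<Longrightarrow> v \<in> V \<Longrightarrow> cls u = cls v \<longleftrightarrow> linked u v"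
proof
  assume "u \<in> V" "v \<in> V" "cls u = cls v"
  with linked_cls[of u] linked_cls[of v] show "linked u v"
    by (metis linked_sym linked_trans)
next
  assume "linked u v"
  then have "linked u = linked v" using linked_sym linked_trans by blast
  then show "cls u = cls v" by (simp add: cls_def)
qed

lemma cls_equal_position: "u \<in> V \<Longrightarrow> v \<in> V \<Longrightarrow> \<phi>\<^sub>0 u = \<phi>\<^sub>0 v \<Longrightarrow> cls u = cls v \<and> off u = off v"
  using cls_eq_iff[of u v] linked_close[of u v] by (simp add: off_def)

sublocale C: rigid_classes Q a w Gr V Eg tar src lab cls off
proof unfold_locales
  show V: "cls v \<in> V" if "v \<in> V" for v using linked_V[OF linked_cls[OF that]] by simp
  show cc: "cls (cls v) = cls v" if "v \<in> V" for v
    using cls_eq_iff[OF V[OF that] that] linked_sym[OF linked_cls[OF that]] by simp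
  show "off (cls v) = 0" if "v \<in> V" for v using cc[OF that] by (simp add: off_def)
next
  fix R assume R: "R \<subseteq> V" "R \<noteq> {}" "R \<noteq> V"
    and inv: "\<And>u v. u \<in> V \<Longrightarrow> v \<in> V \<Longrightarrow> cls u = cls v \<Longrightarrow> u \<in> R \<Longrightarrow> v \<in> R"
  show "\<exists>e\<in>Eg. tar e \<in> R \<and> src e \<notin> R \<or> tar e \<notin> R \<and> src e \<in> R"
  proof (rule pattern_crossing[OF R])
    fix u v assume "u \<in> R" "v \<in> V - R"
    then have "\<not> linked u v" using inv[of u v] cls_eq_iff[of u v] R(1) by blast
    then show "\<bar>\<phi>\<^sub>0 u - \<phi>\<^sub>0 v\<bar> > int D"
      using linked_close[of u v] \<open>u \<in> R\<close> \<open>v \<in> V - R\<close> R(1) by force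
  qed
next
  fix e assume e: "e \<in> Eg" "cls (tar e) \<noteq> cls (src e)"
  then have "\<phi>\<^sub>0 (tar e) \<noteq> \<phi>\<^sub>0 (src e)" using cls_equal_position tar_src by blast
  from pattern_twin[OF e(1) this] obtain e' where e': "e' \<in> Eg" "e' \<noteq> e" "lab e' = lab e"
    "{\<phi>\<^sub>0 (tar e'), \<phi>\<^sub>0 (src e')} = {\<phi>\<^sub>0 (tar e), \<phi>\<^sub>0 (src e)}" by blast
  then show "\<exists>e'\<in>Eg. e' \<noteq> e \<and> lab e' = lab e \<and>
        ((cls (tar e'), off (tar e'), cls (src e'), off (src e')) = (cls (tar e), off (tar e), cls (src e), off (src e)) \<or>
         (cls (tar e'), off (tar e'), cls (src e'), off (src e')) = (cls (src e), off (src e), cls (tar e), off (tar e)))"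
    using cls_equal_position tar_src[OF e(1)] tar_src[OF e'(1)]
    by (intro bexI[of _ e']) (auto simp: doubleton_eq_iff)
qed (use finite_V V_nonempty finite_Eg tar_src lab_Gr in auto)

lemma rigid_maps_diff:
  assumes "\<phi> \<in> rigid_maps V cls off n" "u \<in> V" "v \<in> V" "cls u = cls v"
  shows "\<phi> u - \<phi> v = \<phi>\<^sub>0 u - \<phi>\<^sub>0 v"
proof -
  have "\<phi> u = \<phi> (cls u) + off u" "\<phi> v = \<phi> (cls v) + off v"
    using assms by (auto simp: rigid_maps_def)
  with assms(4) show ?thesis by (simp add: off_def)
qed

section \<open>Sums over the maps of one pattern\<close>

definition pattern_maps :: "nat \<Rightarrow> (nat \<Rightarrow> int) set" where
  "pattern_maps n = {\<phi> \<in> V \<rightarrow>\<^sub>E {0..<int n}. pattern V D \<phi> = pattern V D \<phi>\<^sub>0}"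

lemma pattern_maps_rigid: "pattern_maps n \<subseteq> rigid_maps V cls off n"
proof
  fix \<phi> assume \<phi>: "\<phi> \<in> pattern_maps n"
  have "\<phi> u - \<phi> v = \<phi>\<^sub>0 u - \<phi>\<^sub>0 v" if "linked u v" for u v
    using that unfolding linked_def
  proof (induction rule: trancl_induct)
    case (base y)
    then show ?case using \<phi> pattern_eqD(2)[of V D \<phi> \<phi>\<^sub>0 u y] by (auto simp: pattern_maps_def)
  next
    case (step y z)
    then show ?case using \<phi> pattern_eqD(2)[of V D \<phi> \<phi>\<^sub>0 y z] by (auto simp: pattern_maps_def)
  qed
  from this[OF linked_cls] have "\<phi> v = \<phi> (cls v) + off v" if "v \<in> V" for v
    using that unfolding off_def by force
  with \<phi> show "\<phi> \<in> rigid_maps V cls off n" by (simp add: rigid_maps_def pattern_maps_def)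
qed

text \<open>Inside a class a rigid map has the same differences as \<open>\<phi>\<^sub>0\<close>,
  and in the pattern of \<open>\<phi>\<^sub>0\<close> vertices of different classes are never close.
  The patterns can therefore differ only by an accidental closeness of two classes.\<close>

lemma rigid_not_pattern:
  assumes "\<phi> \<in> rigid_maps V cls off n" "\<phi> \<notin> pattern_maps n"
  shows "\<exists>(u, v, \<delta>)\<in>V \<times> V \<times> {- int D..int D}. cls u \<noteq> cls v \<and> \<phi> u - \<phi> v = \<delta>"
proof (rule ccontr)
  assume "\<not> ?thesis"
  then have no: "cls u = cls v" if "u \<in> V" "v \<in> V" "\<bar>\<phi> u - \<phi> v\<bar> \<le> int D" for u v
    using that by (force simp: abs_le_iff)
  have "\<bar>\<phi> u - \<phi> v\<bar> \<le> int D \<or> \<bar>\<phi>\<^sub>0 u - \<phi>\<^sub>0 v\<bar> \<le> int D \<Longrightarrow> \<phi> u - \<phi> v = \<phi>\<^sub>0 u - \<phi>\<^sub>0 v"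
    if "u \<in> V" "v \<in> V" for u v
    using no[OF that] linked_close[OF that] cls_eq_iff[OF that] rigid_maps_diff[OF assms(1) that] by blast
  note same = this
  have "pattern V D \<phi> = pattern V D \<phi>\<^sub>0"
  proof (rule Set.set_eqI)
    fix x :: "nat \<times> nat \<times> int"
    obtain u v \<delta> where x: "x = (u, v, \<delta>)" by (cases x)
    show "x \<in> pattern V D \<phi> \<longleftrightarrow> x \<in> pattern V D \<phi>\<^sub>0"
      unfolding x pattern_def mem_Collect_eq prod.case using same[of u v] by metis
  qed
  then show False using assms by (simp add: pattern_maps_def rigid_maps_def)
qed

definition pattern_sum :: "nat \<Rightarrow> real" where
  "pattern_sum n = (\<Sum>\<phi>\<in>pattern_maps n. \<Prod>e\<in>Eg. edge_weight a w tar src lab e n \<phi>) / real n"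

lemma pattern_sum_bounds: "0 \<le> pattern_sum n" "pattern_sum n \<le> C.class_sum n"
  unfolding pattern_sum_def C.class_sum_def
  by (intro divide_nonneg_nonneg divide_right_mono sum_nonneg sum_mono2 finite_rigid_maps finite_V
      C.edge_weight_prod_nonneg pattern_maps_rigid; simp)+

lemma pattern_sum_vanishes:
  assumes "card Eg + 2 \<noteq> 2 * card (cls ` V)"
  shows "pattern_sum \<longlonglongrightarrow> 0"
  by (rule tendsto_sandwich[OF always_eventually always_eventually tendsto_const C.class_sum_vanishes[OF assms]])
    (use pattern_sum_bounds in auto)

text \<open>The pattern keeps different classes apart, a condition on pairs of classes that leaf
  removal cannot handle. Dropping it gives the class sum, at the cost of finitely many coincidences,
  each negligible for a doubled tree.\<close>

lemma pattern_sum_convergent: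
  assumes tree: "card Eg + 2 = 2 * card (cls ` V)"
  shows "convergent pattern_sum"
proof -
  let ?wt = "\<lambda>n \<phi>. \<Prod>e\<in>Eg. edge_weight a w tar src lab e n \<phi>"
  let ?I = "{(u, v, \<delta>)\<in>V \<times> V \<times> {- int D..int D}. cls u \<noteq> cls v}"
  let ?B = "\<lambda>n (u, v, \<delta>). {\<phi> \<in> rigid_maps V cls off n. \<phi> u - \<phi> v = \<delta>}"
  have fin: "finite ?I"
    by (rule finite_subset[of _ "V \<times> V \<times> {- int D..int D}"]) (use finite_V in auto)
  have finB: "finite (?B n p)" for n p
    by (rule finite_subset[OF _ finite_rigid_maps[OF finite_V]]) (auto split: prod.splits)
  have "(\<lambda>n. \<Sum>p\<in>?I. (\<Sum>\<phi>\<in>?B n p. ?wt n \<phi>) / real n) \<longlonglongrightarrow> (\<Sum>p\<in>?I. 0)"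
    by (intro tendsto_sum) (use C.rare_coincidence[OF tree] in auto)
  then have upper: "(\<lambda>n. \<Sum>p\<in>?I. (\<Sum>\<phi>\<in>?B n p. ?wt n \<phi>) / real n) \<longlonglongrightarrow> 0" by simp
  have "(\<lambda>n. C.class_sum n - pattern_sum n) \<longlonglongrightarrow> 0"
  proof (rule tendsto_sandwich[OF always_eventually always_eventually tendsto_const upper])
    show "\<forall>n. 0 \<le> C.class_sum n - pattern_sum n" using pattern_sum_bounds by simp
    show "\<forall>n. C.class_sum n - pattern_sum n \<le> (\<Sum>p\<in>?I. (\<Sum>\<phi>\<in>?B n p. ?wt n \<phi>) / real n)"
    proof
      fix n
      have "C.class_sum n - pattern_sum n = (\<Sum>\<phi>\<in>rigid_maps V cls off n - pattern_maps n. ?wt n \<phi>) / real n"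
        unfolding C.class_sum_def pattern_sum_def
        by (subst sum_diff[OF finite_rigid_maps[OF finite_V] pattern_maps_rigid]) (simp add: diff_divide_distrib)
      also have "\<dots> \<le> (\<Sum>\<phi>\<in>(\<Union>p\<in>?I. ?B n p). ?wt n \<phi>) / real n"
      proof (intro divide_right_mono sum_mono2)
        show "rigid_maps V cls off n - pattern_maps n \<subseteq> (\<Union>p\<in>?I. ?B n p)"
          using rigid_not_pattern by fastforce
      qed (use fin finB C.edge_weight_prod_nonneg in auto)
      also have "\<dots> \<le> (\<Sum>p\<in>?I. \<Sum>\<phi>\<in>?B n p. ?wt n \<phi>) / real n"
        by (intro divide_right_mono sum_UN_le fin finB C.edge_weight_prod_nonneg) simp
      finally show "C.class_sum n - pattern_sum n \<le> (\<Sum>p\<in>?I. (\<Sum>\<phi>\<in>?B n p. ?wt n \<phi>) / real n)"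
        by (simp add: sum_divide_distrib)
    qed
  qed
  moreover obtain l where "C.class_sum \<longlonglongrightarrow> l"
    using C.class_sum_convergent[OF tree] by (auto simp: convergent_def)
  ultimately have "(\<lambda>n. C.class_sum n - (C.class_sum n - pattern_sum n)) \<longlonglongrightarrow> l - 0"
    by (intro tendsto_diff)
  then show ?thesis by (auto simp: convergent_def)
qed

text \<open>Being twins in the contracted graph sees only the offset difference and is thus coarser
  than occupying the same two positions. In a doubled tree an edge has just one other twin, while
  \<open>pattern_twin\<close> supplies another edge at the same positions; so both relations single
  out the same pair.\<close>

lemma tree_edge_group:
  assumes tree: "card Eg + 2 = 2 * card (cls ` V)" and e: "e \<in> Eg"
  shows "cls (tar e) \<noteq> cls (src e)"
    and "\<exists>e'. e' \<noteq> e \<and>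
      {x \<in> Eg. lab x = lab e \<and> {\<phi>\<^sub>0 (tar x), \<phi>\<^sub>0 (src x)} = {\<phi>\<^sub>0 (tar e), \<phi>\<^sub>0 (src e)}} = {e, e'}"
proof -
  show ne: "cls (tar e) \<noteq> cls (src e)" using C.G.tree_pairs(1)[OF tree e] .
  obtain e' where e': "e' \<noteq> e" "{x\<in>Eg. C.G.twins e x} = {e, e'}" using C.G.tree_pairs(2)[OF tree e] by blast
  have tw: "C.G.twins e x" if "x \<in> Eg" "lab x = lab e" "{\<phi>\<^sub>0 (tar x), \<phi>\<^sub>0 (src x)} = {\<phi>\<^sub>0 (tar e), \<phi>\<^sub>0 (src e)}" for x
  proof -
    note V = tar_src[OF e, THEN conjunct1] tar_src[OF e, THEN conjunct2]
      tar_src[OF that(1), THEN conjunct1] tar_src[OF that(1), THEN conjunct2]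
    from that(3) consider "\<phi>\<^sub>0 (tar x) = \<phi>\<^sub>0 (tar e)" "\<phi>\<^sub>0 (src x) = \<phi>\<^sub>0 (src e)" |
      "\<phi>\<^sub>0 (tar x) = \<phi>\<^sub>0 (src e)" "\<phi>\<^sub>0 (src x) = \<phi>\<^sub>0 (tar e)"
      by (auto simp: doubleton_eq_iff)
    then show ?thesis
    proof cases
      case 1
      with cls_equal_position[OF V(3,1)] cls_equal_position[OF V(4,2)] that(2) show ?thesis
        by (simp add: C.G.twins_def)
    next
      case 2
      with cls_equal_position[OF V(3,2)] cls_equal_position[OF V(4,1)] that(2) show ?thesis
        by (simp add: C.G.twins_def)
    qed
  qed
  have "\<phi>\<^sub>0 (tar e) \<noteq> \<phi>\<^sub>0 (src e)" using ne cls_equal_position tar_src[OF e] by blast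
  from pattern_twin[OF e this] obtain x where "x \<in> Eg" "x \<noteq> e" "lab x = lab e"
    "{\<phi>\<^sub>0 (tar x), \<phi>\<^sub>0 (src x)} = {\<phi>\<^sub>0 (tar e), \<phi>\<^sub>0 (src e)}" by blast
  note x = this
  have "x \<in> {e, e'}" using tw[OF x(1,3,4)] x(1) e'(2) by blast
  with x have "x = e'" by simp
  with x have "{x \<in> Eg. lab x = lab e \<and> {\<phi>\<^sub>0 (tar x), \<phi>\<^sub>0 (src x)} = {\<phi>\<^sub>0 (tar e), \<phi>\<^sub>0 (src e)}} = {e, e'}"
    using tw e'(2) e by blast
  with e'(1) show "\<exists>e'. e' \<noteq> e \<and>
      {x \<in> Eg. lab x = lab e \<and> {\<phi>\<^sub>0 (tar x), \<phi>\<^sub>0 (src x)} = {\<phi>\<^sub>0 (tar e), \<phi>\<^sub>0 (src e)}} = {e, e'}" by blast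
qed

end

section \<open>Mixed moments of Wigner entries\<close>

text \<open>The product is at most a power of its largest factor, which is among the summands; the 1
  covers the empty product. This reduces mixed moments to moments of single entries.\<close>

lemma prod_le_one_plus_sum_power:
  fixes f :: "'a \<Rightarrow> real"
  assumes "finite A" "\<And>x. x \<in> A \<Longrightarrow> 0 \<le> f x"
  shows "(\<Prod>x\<in>A. f x) \<le> 1 + (\<Sum>x\<in>A. f x ^ card A)"
proof (cases "A = {}")
  case False
  have "Max (f ` A) \<in> f ` A" using assms(1) False by (intro Max_in) auto
  then obtain m where m: "m \<in> A" "f m = Max (f ` A)" by auto
  have "(\<Prod>x\<in>A. f x) \<le> (\<Prod>x\<in>A. f m)"
    using assms m(2) by (intro prod_mono) auto
  also have "\<dots> = f m ^ card A" by simp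
  also have "\<dots> \<le> (\<Sum>x\<in>A. f x ^ card A)"
    using assms m(1) by (intro member_le_sum) auto
  finally show ?thesis by simp
qed simp

lemma cnj_measurable: "cnj \<in> borel_measurable borel"
  by (intro borel_measurable_continuous_onI continuous_intros)

locale wigner_family = prob_space M for M :: "'w measure" +
  fixes I :: "'i set" and X :: "'i \<Rightarrow> nat \<Rightarrow> nat \<Rightarrow> 'w \<Rightarrow> complex"
  assumes wigner: "i \<in> I \<Longrightarrow> wigner_array M (X i)"
    and moments: "i \<in> I \<Longrightarrow> finite_moment M (X i)"
    and indep_arrays: "independent_arrays M I X"
begin

lemma X_measurable: "i \<in> I \<Longrightarrow> j \<le> k \<Longrightarrow> X i j k \<in> borel_measurable M"
  using wigner[of i] unfolding wigner_array_def indep_vars_def triangle_def by force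

lemma X_power_integrable: "i \<in> I \<Longrightarrow> j \<le> k \<Longrightarrow> integrable M (\<lambda>\<omega>. cmod (X i j k \<omega>) ^ p)"
  using moments[of i] unfolding finite_moment_def by blast

lemma expectation_same_law:
  fixes F :: "complex \<Rightarrow> 'b::{banach, second_countable_topology}"
  assumes "i \<in> I" "j \<le> k" "j' \<le> k'" "j = k \<longleftrightarrow> j' = k'" and F: "F \<in> borel_measurable borel"
  shows "expectation (\<lambda>\<omega>. F (X i j k \<omega>)) = expectation (\<lambda>\<omega>. F (X i j' k' \<omega>))"
proof -
  have "distr M borel (X i j k) = distr M borel (X i j' k')"
    using wigner[OF assms(1)] assms(2-4) unfolding wigner_array_def
    by (cases "j = k") (metis, metis le_neq_implies_less)
  then have "(\<integral>z. F z \<partial>distr M borel (X i j k)) = (\<integral>z. F z \<partial>distr M borel (X i j' k'))" by simp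
  then show ?thesis
    using F X_measurable[OF assms(1)] assms(2,3) by (simp add: integral_distr)
qed

text \<open>Independence comes in two layers: between the arrays, and between the entries of one
  array. The product is split into one block per array, each a measurable function of that array,
  and the blocks are then split into entries.\<close>

lemma expectation_prod_entries:
  fixes f :: "'i \<times> nat \<times> nat \<Rightarrow> complex \<Rightarrow> complex"
  assumes J: "finite J" "J \<subseteq> I \<times> triangle"
    and f: "\<And>q. q \<in> J \<Longrightarrow> f q \<in> borel_measurable borel"
    and int: "\<And>i j k. (i, j, k) \<in> J \<Longrightarrow> integrable M (\<lambda>\<omega>. f (i, j, k) (X i j k \<omega>))"
  shows "expectation (\<lambda>\<omega>. \<Prod>(i, j, k)\<in>J. f (i, j, k) (X i j k \<omega>)) =
    (\<Prod>(i, j, k)\<in>J. expectation (\<lambda>\<omega>. f (i, j, k) (X i j k \<omega>)))"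
proof -
  define K where "K i = {p. (i, p) \<in> J}" for i
  have JK: "J = Sigma (fst ` J) K" by (force simp: K_def)
  have finK: "finite (K i)" for i
    using finite_subset[of "K i" "snd ` J"] J(1) by (force simp: K_def)
  have K: "K i \<subseteq> triangle" for i using J(2) by (auto simp: K_def)
  define Y where "Y i \<omega> = (\<Prod>(j, k)\<in>K i. f (i, j, k) (X i j k \<omega>))" for i \<omega>
  have block: "expectation (Y i) = (\<Prod>(j, k)\<in>K i. expectation (\<lambda>\<omega>. f (i, j, k) (X i j k \<omega>)))"
    and block_int: "integrable M (Y i)" if "i \<in> fst ` J" for i
  proof -
    have "i \<in> I" using that J(2) by auto
    then have "indep_vars (\<lambda>_. borel) (\<lambda>(j, k). X i j k) triangle"
      using wigner unfolding wigner_array_def by blast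
    then have "indep_vars (\<lambda>_. borel) (\<lambda>(j, k). X i j k) (K i)"
      using K by (rule indep_vars_subset)
    then have ind: "indep_vars (\<lambda>_. borel) (\<lambda>p \<omega>. f (i, p) ((\<lambda>(j, k). X i j k) p \<omega>)) (K i)"
      by (rule indep_vars_compose2) (use f in \<open>auto simp: K_def\<close>)
    have int': "integrable M (\<lambda>\<omega>. f (i, p) ((\<lambda>(j, k). X i j k) p \<omega>))" if "p \<in> K i" for p
      using int[of i "fst p" "snd p"] that by (auto simp: K_def case_prod_beta)
    show "expectation (Y i) = (\<Prod>(j, k)\<in>K i. expectation (\<lambda>\<omega>. f (i, j, k) (X i j k \<omega>)))"
      using indep_vars_lebesgue_integral[OF finK ind int']
      by (simp add: Y_def[abs_def] case_prod_beta)
    show "integrable M (Y i)"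
      using indep_vars_integrable[OF finK ind int']
      by (simp add: Y_def[abs_def] case_prod_beta)
  qed
  have "indep_vars (\<lambda>_. \<Pi>\<^sub>M _\<in>triangle. borel) (\<lambda>i \<omega>. \<lambda>(j, k)\<in>triangle. X i j k \<omega>) (fst ` J)"
    using indep_arrays unfolding independent_arrays_def
    by (rule indep_vars_subset) (use J(2) in auto)
  then have "indep_vars (\<lambda>_. borel)
      (\<lambda>i \<omega>. \<Prod>p\<in>K i. f (i, p) ((\<lambda>(j, k)\<in>triangle. X i j k \<omega>) p)) (fst ` J)"
  proof (rule indep_vars_compose2)
    fix i assume "i \<in> fst ` J"
    show "(\<lambda>x. \<Prod>p\<in>K i. f (i, p) (x p)) \<in> borel_measurable (\<Pi>\<^sub>M _\<in>triangle. borel)"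
    proof (rule borel_measurable_prod)
      fix p assume "p \<in> K i"
      then show "(\<lambda>x. f (i, p) (x p)) \<in> borel_measurable (\<Pi>\<^sub>M _\<in>triangle. borel)"
        using f[of "(i, p)"] K by (intro measurable_compose[OF measurable_component_singleton]) (auto simp: K_def)
    qed
  qed
  moreover have "(\<Prod>p\<in>K i. f (i, p) ((\<lambda>(j, k)\<in>triangle. X i j k \<omega>) p)) = Y i \<omega>" for i \<omega>
    unfolding Y_def using K by (intro prod.cong refl) (auto simp: case_prod_beta)
  ultimately have "indep_vars (\<lambda>_. borel) Y (fst ` J)" by simp
  then have "expectation (\<lambda>\<omega>. \<Prod>i\<in>fst ` J. Y i \<omega>) = (\<Prod>i\<in>fst ` J. expectation (Y i))"
    using J(1) block_int by (intro indep_vars_lebesgue_integral) auto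
  moreover have "(\<Prod>(i, j, k)\<in>J. f (i, j, k) (X i j k \<omega>)) = (\<Prod>i\<in>fst ` J. Y i \<omega>)" for \<omega>
    unfolding Y_def using J(1) finK by (subst JK, subst prod.Sigma[symmetric]) auto
  moreover have "(\<Prod>(i, j, k)\<in>J. expectation (\<lambda>\<omega>. f (i, j, k) (X i j k \<omega>))) = (\<Prod>i\<in>fst ` J. expectation (Y i))"
    using J(1) finK by (subst JK, subst prod.Sigma[symmetric]) (auto simp: block)
  ultimately show ?thesis by simp
qed

definition entry :: "'i \<Rightarrow> nat \<Rightarrow> nat \<Rightarrow> 'w \<Rightarrow> complex" where
  "entry i j k \<omega> = (if j \<le> k then X i j k \<omega> else cnj (X i k j \<omega>))"

lemma cmod_entry: "cmod (entry i j k \<omega>) = cmod (X i (min j k) (max j k) \<omega>)"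
  by (auto simp: entry_def min_def max_def)

lemma entry_measurable: "i \<in> I \<Longrightarrow> entry i j k \<in> borel_measurable M"
  unfolding entry_def[abs_def] using X_measurable[of i j k] X_measurable[of i k j]
  by (cases "j \<le> k") (auto intro: measurable_compose[OF _ cnj_measurable])

end

locale entry_product = wigner_family M I X
  for M :: "'w measure" and I :: "'i set" and X +
  fixes E :: "nat set" and lab :: "nat \<Rightarrow> 'i"
  assumes finite_E: "finite E" and lab_I: "e \<in> E \<Longrightarrow> lab e \<in> I"
begin

section \<open>Factorization of mixed moments over matrix positions\<close>

definition mixed_moment :: "(nat \<Rightarrow> nat) \<Rightarrow> (nat \<Rightarrow> nat) \<Rightarrow> complex" where
  "mixed_moment r c = expectation (\<lambda>\<omega>. \<Prod>e\<in>E. entry (lab e) (r e) (c e) \<omega>)"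

text \<open>The pair of positions is unordered because the entries at (j, k) and (k, j) are
  conjugates of one variable.\<close>

definition edge_group :: "(nat \<Rightarrow> nat) \<Rightarrow> (nat \<Rightarrow> nat) \<Rightarrow> nat \<Rightarrow> nat set" where
  "edge_group r c e = {x \<in> E. lab x = lab e \<and> {r x, c x} = {r e, c e}}"

definition group_moment :: "(nat \<Rightarrow> nat) \<Rightarrow> (nat \<Rightarrow> nat) \<Rightarrow> nat set \<Rightarrow> complex" where
  "group_moment r c G = expectation (\<lambda>\<omega>. \<Prod>e\<in>G. entry (lab e) (r e) (c e) \<omega>)"

lemma entry_powers_integrable: "e \<in> E \<Longrightarrow> integrable M (\<lambda>\<omega>. cmod (entry (lab e) j k \<omega>) ^ p)"
  unfolding cmod_entry by (rule X_power_integrable[OF lab_I]) auto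

lemma prod_cmod_le:
  "cmod (\<Prod>e\<in>E. entry (lab e) (r e) (c e) \<omega>) \<le> 1 + (\<Sum>e\<in>E. cmod (entry (lab e) (r e) (c e) \<omega>) ^ card E)"
  unfolding prod_norm[symmetric] by (rule prod_le_one_plus_sum_power) (use finite_E in auto)

lemma dominating_integrable:
  "integrable M (\<lambda>\<omega>. 1 + (\<Sum>e\<in>E. cmod (entry (lab e) (r e) (c e) \<omega>) ^ card E))"
  by (intro Bochner_Integration.integrable_add Bochner_Integration.integrable_sum entry_powers_integrable) auto

lemma entry_prod_integrable: "integrable M (\<lambda>\<omega>. \<Prod>e\<in>E. entry (lab e) (r e) (c e) \<omega>)"
proof (rule Bochner_Integration.integrable_bound[OF dominating_integrable[of r c]])
  show "(\<lambda>\<omega>. \<Prod>e\<in>E. entry (lab e) (r e) (c e) \<omega>) \<in> borel_measurable M"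
    by (intro borel_measurable_prod entry_measurable lab_I)
qed (auto intro!: AE_I2 order_trans[OF prod_cmod_le])

text \<open>For each label only two laws occur, on and off the diagonal, so the bound does not
  depend on the positions.\<close>

lemma mixed_moment_bounded: "\<exists>C. \<forall>r c. cmod (mixed_moment r c) \<le> C"
proof (intro exI allI)
  fix r c :: "nat \<Rightarrow> nat"
  let ?m = "\<lambda>e k. expectation (\<lambda>\<omega>. cmod (X (lab e) 0 k \<omega>) ^ card E)"
  have "cmod (mixed_moment r c) \<le> expectation (\<lambda>\<omega>. cmod (\<Prod>e\<in>E. entry (lab e) (r e) (c e) \<omega>))"
    unfolding mixed_moment_def by (rule integral_norm_bound)
  also have "\<dots> \<le> expectation (\<lambda>\<omega>. 1 + (\<Sum>e\<in>E. cmod (entry (lab e) (r e) (c e) \<omega>) ^ card E))"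
    by (intro integral_mono prod_cmod_le dominating_integrable integrable_norm entry_prod_integrable)
  also have "\<dots> = 1 + (\<Sum>e\<in>E. expectation (\<lambda>\<omega>. cmod (entry (lab e) (r e) (c e) \<omega>) ^ card E))"
    using entry_powers_integrable
    by (subst Bochner_Integration.integral_add) (auto simp: Bochner_Integration.integral_sum prob_space)
  also have "\<dots> \<le> 1 + (\<Sum>e\<in>E. ?m e 0 + ?m e 1)"
  proof (intro add_left_mono sum_mono)
    fix e assume e: "e \<in> E"
    \<comment> \<open>The entries at (0, 0) and (0, 1) represent the diagonal and the off-diagonal
      law.\<close>
    have "expectation (\<lambda>\<omega>. cmod (entry (lab e) (r e) (c e) \<omega>) ^ card E) = ?m e (of_bool (r e \<noteq> c e))"
      unfolding cmod_entry
      by (rule expectation_same_law[OF lab_I[OF e]]) (auto simp: min_def max_def)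
    moreover have "0 \<le> ?m e 0" "0 \<le> ?m e 1" by auto
    ultimately show "expectation (\<lambda>\<omega>. cmod (entry (lab e) (r e) (c e) \<omega>) ^ card E) \<le> ?m e 0 + ?m e 1"
      by (cases "r e = c e") auto
  qed
  finally show "cmod (mixed_moment r c) \<le> 1 + (\<Sum>e\<in>E. ?m e 0 + ?m e 1)" .
qed

text \<open>A group of edges involves a single random variable \<open>z\<close>; its product of
  entries is a monomial in \<open>z\<close> and its conjugate, with the conjugate taken below the
  diagonal.\<close>

definition word :: "(nat \<Rightarrow> nat) \<Rightarrow> (nat \<Rightarrow> nat) \<Rightarrow> nat set \<Rightarrow> complex \<Rightarrow> complex" where
  "word r c G z = (\<Prod>e\<in>G. if r e \<le> c e then z else cnj z)"

lemma word_measurable: "word r c G \<in> borel_measurable borel"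
  unfolding word_def[abs_def] using cnj_measurable by (intro borel_measurable_prod) (simp split: if_split)

lemma cmod_word: "cmod (word r c G z) = cmod z ^ card G"
  unfolding word_def prod_norm[symmetric] by (simp add: if_distrib cong: if_cong)

lemma entry_prod_word:
  assumes "\<And>e. e \<in> G \<Longrightarrow> lab e = i \<and> {r e, c e} = {j, k}" "j \<le> k"
  shows "(\<Prod>e\<in>G. entry (lab e) (r e) (c e) \<omega>) = word r c G (X i j k \<omega>)"
  unfolding word_def
proof (intro prod.cong refl)
  fix e assume "e \<in> G"
  from assms(1)[OF this] assms(2)
  show "entry (lab e) (r e) (c e) \<omega> = (if r e \<le> c e then X i j k \<omega> else cnj (X i j k \<omega>))"
    by (auto simp: entry_def doubleton_eq_iff)
qed

text \<open>Label and sorted positions identify the variable behind an entry, so different groups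
  depend on different, hence independent, variables.\<close>

lemma mixed_moment_groups:
  "mixed_moment r c = (\<Prod>G\<in>edge_group r c ` E. group_moment r c G)"
proof -
  define idx where "idx e = (lab e, min (r e) (c e), max (r e) (c e))" for e
  define grp where "grp q = {e \<in> E. idx e = q}" for q
  have idx_eq: "idx x = idx e \<longleftrightarrow> lab x = lab e \<and> {r x, c x} = {r e, c e}" for x e
    by (auto simp: idx_def doubleton_eq_iff min_def max_def)
  have grp: "edge_group r c e = grp (idx e)" for e
    by (simp add: edge_group_def grp_def idx_eq)
  have word: "(\<Prod>e\<in>grp (i, j, k). entry (lab e) (r e) (c e) \<omega>) = word r c (grp (i, j, k)) (X i j k \<omega>)"
    if "(i, j, k) \<in> idx ` E" for i j k \<omega>
  proof (rule entry_prod_word)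
    show "lab e = i \<and> {r e, c e} = {j, k}" if "e \<in> grp (i, j, k)" for e
      using that by (cases "r e \<le> c e") (auto simp: grp_def idx_def)
    show "j \<le> k" using that by (auto simp: idx_def)
  qed
  have "mixed_moment r c = expectation (\<lambda>\<omega>. \<Prod>q\<in>idx ` E. \<Prod>e\<in>grp q. entry (lab e) (r e) (c e) \<omega>)"
    unfolding mixed_moment_def grp_def using finite_E by (subst prod.image_gen[OF finite_E, of _ idx]) simp
  also have "\<dots> = expectation (\<lambda>\<omega>. \<Prod>(i, j, k)\<in>idx ` E. word r c (grp (i, j, k)) (X i j k \<omega>))"
  proof (intro Bochner_Integration.integral_cong prod.cong refl)
    fix \<omega> q assume "q \<in> idx ` E"
    then show "(\<Prod>e\<in>grp q. entry (lab e) (r e) (c e) \<omega>) =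
        (case q of (i, j, k) \<Rightarrow> word r c (grp (i, j, k)) (X i j k \<omega>))"
      using word by (cases q) simp
  qed
  also have "\<dots> = (\<Prod>(i, j, k)\<in>idx ` E. expectation (\<lambda>\<omega>. word r c (grp (i, j, k)) (X i j k \<omega>)))"
  proof (rule expectation_prod_entries)
    show "idx ` E \<subseteq> I \<times> triangle" using lab_I by (auto simp: idx_def triangle_def)
    fix i j k assume q: "(i, j, k) \<in> idx ` E"
    then have ijk: "i \<in> I" "j \<le> k" using lab_I by (auto simp: idx_def)
    show "integrable M (\<lambda>\<omega>. word r c (grp (i, j, k)) (X i j k \<omega>))"
      by (rule Bochner_Integration.integrable_bound[OF X_power_integrable[OF ijk, of "card (grp (i, j, k))"]])
        (use measurable_compose[OF X_measurable[OF ijk] word_measurable] in \<open>auto simp: cmod_word\<close>)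
  qed (use finite_E word_measurable in auto)
  also have "\<dots> = (\<Prod>q\<in>idx ` E. group_moment r c (grp q))"
  proof (intro prod.cong refl)
    fix q assume "q \<in> idx ` E"
    then show "(case q of (i, j, k) \<Rightarrow> expectation (\<lambda>\<omega>. word r c (grp (i, j, k)) (X i j k \<omega>))) =
        group_moment r c (grp q)"
      using word by (cases q) (simp add: group_moment_def)
  qed
  \<comment> \<open>The groups are nonempty and therefore determine their index, so the reindexing
    is injective.\<close>
  also have "\<dots> = (\<Prod>G\<in>grp ` idx ` E. group_moment r c G)"
    by (subst prod.reindex) (auto simp: inj_on_def grp_def)
  also have "grp ` idx ` E = edge_group r c ` E" by (simp add: image_image grp)
  finally show ?thesis .
qed

lemma single_edge_moment:
  assumes "e \<in> E" "r e \<noteq> c e"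
  shows "group_moment r c {e} = 0"
proof -
  have zero: "expectation (X (lab e) j k) = 0" if "j < k" for j k
    using wigner[OF lab_I[OF assms(1)]] that unfolding wigner_array_def by blast
  show ?thesis
    using assms(2) zero[of "r e" "c e"] zero[of "c e" "r e"]
    by (cases "r e \<le> c e") (auto simp: group_moment_def entry_def)
qed

lemma mixed_moment_single:
  assumes "e \<in> E" "r e \<noteq> c e" "edge_group r c e = {e}"
  shows "mixed_moment r c = 0"
  unfolding mixed_moment_groups
  using assms single_edge_moment finite_E by (intro prod_zero) (auto intro!: bexI[of _ e])

text \<open>The order of the ends determines the monomial, and equality of the ends determines the
  law of the variable. This serves groups of fixed band width, which can have any size but whose
  order is fixed by the pattern.\<close>

lemma group_moment_same_order:
  assumes "e \<in> E" and G: "G = edge_group r c e" "G = edge_group r' c' e"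
    and order: "\<And>x. x \<in> G \<Longrightarrow> (r x \<le> c x \<longleftrightarrow> r' x \<le> c' x) \<and> (r x = c x \<longleftrightarrow> r' x = c' x)"
  shows "group_moment r c G = group_moment r' c' G"
proof -
  have eG: "e \<in> G" using assms(1) G(1) by (simp add: edge_group_def)
  have w: "word r c G = word r' c' G" unfolding word_def using order by (intro ext prod.cong) auto
  have "group_moment r c G = expectation (\<lambda>\<omega>. word r c G (X (lab e) (min (r e) (c e)) (max (r e) (c e)) \<omega>))"
    unfolding group_moment_def
    by (intro Bochner_Integration.integral_cong refl entry_prod_word)
      (auto simp: G(1) edge_group_def min_def max_def)
  also have "\<dots> = expectation (\<lambda>\<omega>. word r c G (X (lab e) (min (r' e) (c' e)) (max (r' e) (c' e)) \<omega>))"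
    by (rule expectation_same_law[OF lab_I[OF assms(1)] _ _ _ word_measurable])
      (use order[OF eG] in \<open>auto simp: min_def max_def\<close>)
  also have "\<dots> = group_moment r' c' G"
    unfolding group_moment_def w
    by (intro Bochner_Integration.integral_cong refl entry_prod_word[symmetric])
      (auto simp: G(2) edge_group_def min_def max_def)
  finally show ?thesis .
qed

text \<open>Twins in opposite directions produce the second absolute moment 1. Parallel twins
  produce the second moment above the diagonal and its conjugate below; a real parameter makes the
  two agree, as is required when the pattern leaves the order of the ends open.\<close>

lemma pair_moment:
  assumes "e \<in> E" "e' \<noteq> e" "lab e' = lab e" "{r e', c e'} = {r e, c e}" "r e \<noteq> c e"
    and real: "wigner_parameter M (X (lab e)) \<in> \<real>"
  shows "group_moment r c {e, e'} = (if r e' = r e then wigner_parameter M (X (lab e)) else 1)"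
proof -
  let ?i = "lab e" and ?j = "min (r e) (c e)" and ?k = "max (r e) (c e)"
  have i: "?i \<in> I" and jk: "?j < ?k" using assms lab_I by auto
  have sq: "expectation (\<lambda>\<omega>. (X ?i ?j ?k \<omega>)\<^sup>2) = wigner_parameter M (X ?i)"
    unfolding wigner_parameter_def by (rule expectation_same_law[OF i]) (use assms(5) in \<open>auto simp: min_def max_def\<close>)
  have csq: "expectation (\<lambda>\<omega>. (cnj (X ?i ?j ?k \<omega>))\<^sup>2) = wigner_parameter M (X ?i)"
  proof -
    have "expectation (\<lambda>\<omega>. (cnj (X ?i ?j ?k \<omega>))\<^sup>2) = cnj (expectation (\<lambda>\<omega>. (X ?i ?j ?k \<omega>)\<^sup>2))"
      unfolding complex_cnj_power[symmetric] by (rule Bochner_Integration.integral_cnj)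
    with sq real show ?thesis by (simp add: Reals_cnj_iff)
  qed
  have abs: "expectation (\<lambda>\<omega>. X ?i ?j ?k \<omega> * cnj (X ?i ?j ?k \<omega>)) = 1"
  proof -
    have "expectation (\<lambda>\<omega>. (cmod (X ?i ?j ?k \<omega>))\<^sup>2) = 1"
      using wigner[OF i] jk unfolding wigner_array_def by blast
    then show ?thesis
      by (simp only: complex_norm_square[symmetric]) (simp only: integral_complex_of_real of_real_1)
  qed
  have ends: "r e' = r e \<and> c e' = c e \<or> r e' = c e \<and> c e' = r e"
    using assms(4) by (auto simp: doubleton_eq_iff)
  have prod: "(\<Prod>x\<in>{e, e'}. entry (lab x) (r x) (c x) \<omega>) = entry ?i (r e) (c e) \<omega> * entry ?i (r e') (c e') \<omega>" for \<omega>
    using assms(2,3) by simp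
  show ?thesis
  proof (cases "r e \<le> c e")
    case True
    with assms(5) have "r e < c e" by simp
    then show ?thesis
      using sq abs ends assms(5) unfolding group_moment_def prod
      by (auto simp: entry_def min_def max_def power2_eq_square)
  next
    case False
    then show ?thesis
      using csq abs ends assms(5) unfolding group_moment_def prod
      by (auto simp: entry_def min_def max_def power2_eq_square mult.commute)
  qed
qed

end

section \<open>Moments of test graphs\<close>

text \<open>Labels outside \<open>Gr\<close> have constant scale and width, for which the values at
  index 0 stand; \<open>D\<close> bounds these widths.\<close>

locale band_model = growing_scales Q a w Gr + entry_product M I X E lab
  for Q and a :: "'i \<Rightarrow> nat \<Rightarrow> real" and w Gr
    and M :: "'w measure" and I :: "'i set" and X E lab +
  fixes V :: "nat set" and tar src :: "nat \<Rightarrow> nat" and D :: nat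
  assumes finite_V: "finite V" and V_nonempty: "V \<noteq> {}"
    and tar_src: "e \<in> E \<Longrightarrow> tar e \<in> V \<and> src e \<in> V"
    and fixed_scale: "e \<in> E \<Longrightarrow> lab e \<notin> Gr \<Longrightarrow>
      a (lab e) n = a (lab e) 0 \<and> w (lab e) n = w (lab e) 0 \<and> w (lab e) 0 \<le> D"
    and graph_crossing: "R \<subseteq> V \<Longrightarrow> R \<noteq> {} \<Longrightarrow> R \<noteq> V \<Longrightarrow>
      \<exists>e\<in>E. tar e \<in> R \<and> src e \<notin> R \<or> tar e \<notin> R \<and> src e \<in> R"
    and real_parameter: "e \<in> E \<Longrightarrow> wigner_parameter M (X (lab e)) \<in> \<real>"
begin

abbreviation Eg :: "nat set" where "Eg \<equiv> {e \<in> E. lab e \<in> Gr}"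
abbreviation Ef :: "nat set" where "Ef \<equiv> {e \<in> E. lab e \<notin> Gr}"
abbreviation wt :: "nat \<Rightarrow> nat \<Rightarrow> (nat \<Rightarrow> int) \<Rightarrow> real" where
  "wt e n \<phi> \<equiv> edge_weight a w tar src lab e n \<phi>"

text \<open>Positions are integers here so that differences and offsets can be negative; on the maps
  that are summed over, all values are nonnegative and \<open>nat\<close> is faithful.\<close>

definition moment_at :: "(nat \<Rightarrow> int) \<Rightarrow> complex" where
  "moment_at \<phi> = mixed_moment (\<lambda>e. nat (\<phi> (tar e))) (\<lambda>e. nat (\<phi> (src e)))"

definition position_group :: "(nat \<Rightarrow> int) \<Rightarrow> nat \<Rightarrow> nat set" where
  "position_group \<phi> e = {x \<in> E. lab x = lab e \<and> {\<phi> (tar x), \<phi> (src x)} = {\<phi> (tar e), \<phi> (src e)}}"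

definition term_sum :: "(nat \<times> nat \<times> int) set \<Rightarrow> nat \<Rightarrow> complex" where
  "term_sum P n = (\<Sum>\<phi>\<in>{\<phi> \<in> V \<rightarrow>\<^sub>E {0..<int n}. pattern V D \<phi> = P}.
     of_real (\<Prod>e\<in>E. wt e n \<phi>) * moment_at \<phi>) / of_nat n"

lemma edge_group_nat:
  assumes "\<phi> \<in> V \<rightarrow>\<^sub>E {0..<int n}" "e \<in> E"
  shows "edge_group (\<lambda>e. nat (\<phi> (tar e))) (\<lambda>e. nat (\<phi> (src e))) e = position_group \<phi> e"
proof -
  have nat_eq: "nat (\<phi> u) = nat (\<phi> v) \<longleftrightarrow> \<phi> u = \<phi> v" if "u \<in> V" "v \<in> V" for u v
    using that assms(1) by (auto simp: PiE_def Pi_def eq_nat_nat_iff)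
  show ?thesis
    unfolding edge_group_def position_group_def
    using tar_src nat_eq assms(2) by (intro Collect_cong conj_cong refl) (simp add: doubleton_eq_iff)
qed

lemma pattern_position:
  assumes "pattern V D \<phi> = pattern V D \<phi>\<^sub>0" "u \<in> V" "v \<in> V"
  shows "\<phi> u = \<phi> v \<longleftrightarrow> \<phi>\<^sub>0 u = \<phi>\<^sub>0 v"
  using pattern_eqD[OF assms] by force

lemma pattern_position_group:
  assumes "pattern V D \<phi> = pattern V D \<phi>\<^sub>0" "e \<in> E"
  shows "position_group \<phi> e = position_group \<phi>\<^sub>0 e"
  unfolding position_group_def
  using tar_src pattern_position[OF assms(1)] assms(2)
  by (intro Collect_cong conj_cong refl) (simp add: doubleton_eq_iff)

lemma moment_at_groups:
  assumes "\<phi> \<in> V \<rightarrow>\<^sub>E {0..<int n}"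
  shows "moment_at \<phi> = (\<Prod>G\<in>position_group \<phi> ` E.
    group_moment (\<lambda>e. nat (\<phi> (tar e))) (\<lambda>e. nat (\<phi> (src e))) G)"
proof -
  have "edge_group (\<lambda>e. nat (\<phi> (tar e))) (\<lambda>e. nat (\<phi> (src e))) ` E = position_group \<phi> ` E"
    using edge_group_nat[OF assms] by (intro image_cong) auto
  then show ?thesis unfolding moment_at_def mixed_moment_groups by simp
qed

lemma moment_at_lonely_edge:
  assumes "\<phi> \<in> V \<rightarrow>\<^sub>E {0..<int n}" "e \<in> E" "\<phi> (tar e) \<noteq> \<phi> (src e)" "position_group \<phi> e = {e}"
  shows "moment_at \<phi> = 0"
  unfolding moment_at_def
proof (rule mixed_moment_single[OF assms(2)])
  show "nat (\<phi> (tar e)) \<noteq> nat (\<phi> (src e))"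
    using assms(1,3) tar_src[OF assms(2)] by (auto simp: PiE_def Pi_def eq_nat_nat_iff)
  show "edge_group (\<lambda>e. nat (\<phi> (tar e))) (\<lambda>e. nat (\<phi> (src e))) e = {e}"
    using edge_group_nat[OF assms(1,2)] assms(4) by simp
qed

lemma fixed_weight:
  assumes "pattern V D \<phi> = pattern V D \<phi>\<^sub>0"
  shows "(\<Prod>e\<in>Ef. wt e n \<phi>) = (\<Prod>e\<in>Ef. wt e 0 \<phi>\<^sub>0)"
proof (intro prod.cong refl)
  fix e assume "e \<in> Ef"
  then have e: "e \<in> E" "lab e \<notin> Gr" by auto
  note pat = pattern_eqD[OF assms tar_src[OF e(1), THEN conjunct1] tar_src[OF e(1), THEN conjunct2]]
  have D: "int (w (lab e) 0) \<le> int D" using fixed_scale[OF e] by simp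
  have "\<bar>\<phi> (tar e) - \<phi> (src e)\<bar> \<le> int (w (lab e) 0) \<longleftrightarrow> \<bar>\<phi>\<^sub>0 (tar e) - \<phi>\<^sub>0 (src e)\<bar> \<le> int (w (lab e) 0)"
    using pat D by (cases "\<bar>\<phi>\<^sub>0 (tar e) - \<phi>\<^sub>0 (src e)\<bar> \<le> int D") auto
  then show "wt e n \<phi> = wt e 0 \<phi>\<^sub>0"
    using fixed_scale[OF e, of n] by (simp add: edge_weight_def)
qed

text \<open>If the pattern breaks the band condition of a fixed edge, or leaves a growing edge
  without companion between distinct positions, every summand is 0. Otherwise the growing edges
  satisfy the conditions of a close pattern: a doubled tree has a constant moment and a convergent
  weight, and in all other cases the moments are bounded while the weight tends to 0.\<close>

lemma term_sum_convergent: "convergent (term_sum P)"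
proof (cases "\<exists>n. \<exists>\<phi>\<in>V \<rightarrow>\<^sub>E {0..<int n}. pattern V D \<phi> = P")
  case False
  then have "term_sum P = (\<lambda>_. 0)" unfolding term_sum_def by (intro ext) (auto intro!: sum.neutral)
  then show ?thesis by (simp add: convergent_const)
next
  case True
  then obtain n0 \<phi>\<^sub>0 where \<phi>\<^sub>0: "\<phi>\<^sub>0 \<in> V \<rightarrow>\<^sub>E {0..<int n0}" and P: "P = pattern V D \<phi>\<^sub>0" by blast
  define \<kappa> where "\<kappa> = (\<Prod>e\<in>Ef. wt e 0 \<phi>\<^sub>0)"
  let ?W = "\<lambda>n \<phi>. \<Prod>e\<in>Eg. wt e n \<phi>"
  let ?S = "\<lambda>n. {\<phi> \<in> V \<rightarrow>\<^sub>E {0..<int n}. pattern V D \<phi> = pattern V D \<phi>\<^sub>0}"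
  have split: "term_sum P n = (\<Sum>\<phi>\<in>?S n. of_real (\<kappa> * ?W n \<phi>) * moment_at \<phi>) / of_nat n" for n
  proof -
    have "(\<Prod>e\<in>E. wt e n \<phi>) = \<kappa> * ?W n \<phi>" if "pattern V D \<phi> = pattern V D \<phi>\<^sub>0" for \<phi>
    proof -
      have "E = Eg \<union> Ef" by auto
      then have "(\<Prod>e\<in>E. wt e n \<phi>) = ?W n \<phi> * (\<Prod>e\<in>Ef. wt e n \<phi>)"
        using prod.union_disjoint[of Eg Ef "\<lambda>e. wt e n \<phi>"] finite_E by auto
      with fixed_weight[OF that] show ?thesis by (simp add: \<kappa>_def)
    qed
    then show ?thesis unfolding term_sum_def P
      by (intro arg_cong2[where f = "(/)"] sum.cong refl) auto
  qed
  consider (cut) e where "e \<in> Ef" "\<bar>\<phi>\<^sub>0 (tar e) - \<phi>\<^sub>0 (src e)\<bar> > int (w (lab e) 0)"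
    | (lonely) e where "e \<in> Eg" "\<phi>\<^sub>0 (tar e) \<noteq> \<phi>\<^sub>0 (src e)" "position_group \<phi>\<^sub>0 e = {e}"
    | (regular) "\<And>e. e \<in> Ef \<Longrightarrow> \<bar>\<phi>\<^sub>0 (tar e) - \<phi>\<^sub>0 (src e)\<bar> \<le> int (w (lab e) 0)"
      "\<And>e. e \<in> Eg \<Longrightarrow> \<phi>\<^sub>0 (tar e) \<noteq> \<phi>\<^sub>0 (src e) \<Longrightarrow> position_group \<phi>\<^sub>0 e \<noteq> {e}"
    by (meson not_less)
  then show ?thesis
  proof cases
    case cut
    then have "\<kappa> = 0" unfolding \<kappa>_def
      using finite_E by (intro prod_zero) (auto intro!: bexI[of _ e] simp: edge_weight_def)
    then have "term_sum P = (\<lambda>_. 0)" by (intro ext) (simp add: split)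
    then show ?thesis by (simp add: convergent_const)
  next
    case lonely
    then have e: "e \<in> E" by simp
    have "moment_at \<phi> = 0" if "\<phi> \<in> ?S n" for \<phi> n
      by (rule moment_at_lonely_edge[of \<phi> n e])
        (use that e lonely pattern_position[of \<phi> \<phi>\<^sub>0 "tar e" "src e"] tar_src[OF e]
          pattern_position_group[of \<phi> \<phi>\<^sub>0 e] in auto)
    then have "(\<Sum>\<phi>\<in>?S n. of_real (\<kappa> * ?W n \<phi>) * moment_at \<phi>) = 0" for n
      by (intro sum.neutral ballI) (simp only: mult_zero_right)
    then have "term_sum P = (\<lambda>_. 0)" by (intro ext) (simp only: split div_0)
    then show ?thesis by (simp add: convergent_const)
  next
    case regular
    interpret CP: close_pattern Q a w Gr V Eg tar src lab D \<phi>\<^sub>0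
    proof unfold_locales
      fix R assume R: "R \<subseteq> V" "R \<noteq> {}" "R \<noteq> V"
        and far: "\<And>u v. u \<in> R \<Longrightarrow> v \<in> V - R \<Longrightarrow> \<bar>\<phi>\<^sub>0 u - \<phi>\<^sub>0 v\<bar> > int D"
      \<comment> \<open>An edge across this cut spans more than \<open>D\<close>, whereas in a
        regular pattern the fixed edges span at most \<open>D\<close>.\<close>
      obtain e where e: "e \<in> E" "tar e \<in> R \<and> src e \<notin> R \<or> tar e \<notin> R \<and> src e \<in> R"
        using graph_crossing[OF R] by blast
      have "\<bar>\<phi>\<^sub>0 (tar e) - \<phi>\<^sub>0 (src e)\<bar> > int D"
        using e far[of "tar e" "src e"] far[of "src e" "tar e"] tar_src[OF e(1)] by (auto simp: abs_minus_commute)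
      then have "lab e \<in> Gr" using regular(1)[of e] e(1) fixed_scale[OF e(1), of 0] by force
      with e show "\<exists>e\<in>Eg. tar e \<in> R \<and> src e \<notin> R \<or> tar e \<notin> R \<and> src e \<in> R" by blast
    next
      fix e assume e: "e \<in> Eg" "\<phi>\<^sub>0 (tar e) \<noteq> \<phi>\<^sub>0 (src e)"
      have "e \<in> position_group \<phi>\<^sub>0 e" using e by (simp add: position_group_def)
      with regular(2)[OF e] obtain e' where "e' \<in> position_group \<phi>\<^sub>0 e" "e' \<noteq> e" by blast
      with e(1) show "\<exists>e'\<in>Eg. e' \<noteq> e \<and> lab e' = lab e \<and> {\<phi>\<^sub>0 (tar e'), \<phi>\<^sub>0 (src e')} = {\<phi>\<^sub>0 (tar e), \<phi>\<^sub>0 (src e)}"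
        by (intro bexI[of _ e']) (auto simp: position_group_def)
    qed (use finite_V V_nonempty finite_E tar_src in auto)
    have S: "?S n = CP.pattern_maps n" for n by (simp add: CP.pattern_maps_def)
    show ?thesis
    proof (cases "card Eg + 2 = 2 * card (CP.cls ` V)")
      case False
      obtain C where C: "\<And>r c. cmod (mixed_moment r c) \<le> C" using mixed_moment_bounded by blast
      have "term_sum P \<longlonglongrightarrow> 0"
      proof (rule Lim_null_comparison)
        show "(\<lambda>n. \<bar>\<kappa>\<bar> * C * CP.pattern_sum n) \<longlonglongrightarrow> 0"
          using tendsto_mult[OF tendsto_const CP.pattern_sum_vanishes[OF False], of "\<bar>\<kappa>\<bar> * C"] by simp
        have "norm (term_sum P n) \<le> \<bar>\<kappa>\<bar> * C * CP.pattern_sum n" for n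
        proof -
          have "norm (\<Sum>\<phi>\<in>?S n. of_real (\<kappa> * ?W n \<phi>) * moment_at \<phi>) \<le> (\<Sum>\<phi>\<in>?S n. \<bar>\<kappa>\<bar> * C * ?W n \<phi>)"
          proof (rule order_trans[OF norm_sum sum_mono])
            fix \<phi>
            have "norm (of_real (\<kappa> * ?W n \<phi>) * moment_at \<phi>) = \<bar>\<kappa>\<bar> * ?W n \<phi> * cmod (moment_at \<phi>)"
              using CP.C.edge_weight_prod_nonneg[of n \<phi>] by (simp only: norm_mult norm_of_real abs_mult abs_of_nonneg)
            also have "\<dots> \<le> \<bar>\<kappa>\<bar> * ?W n \<phi> * C"
              unfolding moment_at_def
              by (intro mult_left_mono C mult_nonneg_nonneg CP.C.edge_weight_prod_nonneg) simp
            finally show "norm (of_real (\<kappa> * ?W n \<phi>) * moment_at \<phi>) \<le> \<bar>\<kappa>\<bar> * C * ?W n \<phi>"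
              by (simp only: mult_ac)
          qed
          then have "norm (term_sum P n) \<le> (\<Sum>\<phi>\<in>?S n. \<bar>\<kappa>\<bar> * C * ?W n \<phi>) / real n"
            unfolding split by (simp only: norm_divide norm_of_nat) (rule divide_right_mono, auto)
          also have "\<dots> = \<bar>\<kappa>\<bar> * C * CP.pattern_sum n"
            unfolding S CP.pattern_sum_def by (simp only: sum_distrib_left[symmetric] times_divide_eq_right)
          finally show ?thesis .
        qed
        then show "\<forall>\<^sub>F n in sequentially. norm (term_sum P n) \<le> \<bar>\<kappa>\<bar> * C * CP.pattern_sum n" by simp
      qed
      then show ?thesis by (auto simp: convergent_def)
    next
      case tree: True
      \<comment> \<open>The moment is compared group by group. A fixed group keeps the order of its
        ends, since the pattern records the difference; a growing group is a pair, whose ends may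
        change order but not their relative direction.\<close>
      have const: "moment_at \<phi> = moment_at \<phi>\<^sub>0" if \<phi>: "\<phi> \<in> ?S n" for \<phi> n
      proof -
        have pat: "pattern V D \<phi> = pattern V D \<phi>\<^sub>0" and \<phi>1: "\<phi> \<in> V \<rightarrow>\<^sub>E {0..<int n}" using \<phi> by auto
        have groups: "position_group \<phi> ` E = position_group \<phi>\<^sub>0 ` E"
          using pattern_position_group[OF pat] by (intro image_cong) auto
        have nonneg: "0 \<le> \<phi> v" "0 \<le> \<phi>\<^sub>0 v" if "v \<in> V" for v
          using \<phi>1 \<phi>\<^sub>0 that by (auto simp: PiE_def Pi_def)
        let ?r = "\<lambda>e. nat (\<phi> (tar e))" and ?c = "\<lambda>e. nat (\<phi> (src e))"
        let ?rb = "\<lambda>e. nat (\<phi>\<^sub>0 (tar e))" and ?cb = "\<lambda>e. nat (\<phi>\<^sub>0 (src e))"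
        have "group_moment ?r ?c G = group_moment ?rb ?cb G" if G_in: "G \<in> position_group \<phi>\<^sub>0 ` E" for G
        proof -
          obtain e where e: "e \<in> E" "G = position_group \<phi>\<^sub>0 e" using G_in by blast
          have G: "G = edge_group ?r ?c e" "G = edge_group ?rb ?cb e"
            using edge_group_nat[OF \<phi>1 e(1)] edge_group_nat[OF \<phi>\<^sub>0 e(1)] pattern_position_group[OF pat e(1)] e(2)
            by auto
          show ?thesis
          proof (cases "lab e \<in> Gr")
            case False
            show ?thesis
            proof (rule group_moment_same_order[OF e(1) G])
              fix x assume "x \<in> G"
              then have x: "x \<in> E" "lab x = lab e" using e(2) by (auto simp: position_group_def)
              then have "x \<in> Ef" using False by simp
              then have "\<bar>\<phi>\<^sub>0 (tar x) - \<phi>\<^sub>0 (src x)\<bar> \<le> int D"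
                using regular(1)[of x] fixed_scale[of x 0] by force
              then have "\<phi> (tar x) - \<phi> (src x) = \<phi>\<^sub>0 (tar x) - \<phi>\<^sub>0 (src x)"
                using pattern_eqD(2)[OF pat] tar_src[OF x(1)] by blast
              then show "(?r x \<le> ?c x \<longleftrightarrow> ?rb x \<le> ?cb x) \<and> (?r x = ?c x \<longleftrightarrow> ?rb x = ?cb x)"
                using nonneg tar_src[OF x(1)] by (auto simp: nat_le_eq_zle eq_nat_nat_iff)
            qed
          next
            case True
            then have eg: "e \<in> Eg" using e by simp
            have pg: "position_group \<phi>\<^sub>0 e = {x \<in> Eg. lab x = lab e \<and> {\<phi>\<^sub>0 (tar x), \<phi>\<^sub>0 (src x)} = {\<phi>\<^sub>0 (tar e), \<phi>\<^sub>0 (src e)}}"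
              using True by (auto simp: position_group_def)
            obtain e' where e': "e' \<noteq> e" "G = {e, e'}"
              using CP.tree_edge_group(2)[OF tree eg] e(2) pg by auto
            have mem: "e' \<in> edge_group ?r ?c e" "e' \<in> edge_group ?rb ?cb e" "e' \<in> E"
              using e'(2) G by (auto simp: edge_group_def)
            have lab: "lab e' = lab e" using mem(1) by (simp add: edge_group_def)
            have ne: "\<phi>\<^sub>0 (tar e) \<noteq> \<phi>\<^sub>0 (src e)"
              using CP.tree_edge_group(1)[OF tree eg] CP.cls_equal_position tar_src[OF e(1)] by blast
            then have ne': "\<phi> (tar e) \<noteq> \<phi> (src e)" using pattern_position[OF pat] tar_src[OF e(1)] by blast
            have same: "?r e' = ?r e \<longleftrightarrow> ?rb e' = ?rb e"
              using pattern_position[OF pat] tar_src[OF e(1)] tar_src[OF mem(3)] nonneg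
              by (simp add: eq_nat_nat_iff)
            have "group_moment ?r ?c {e, e'} = (if ?r e' = ?r e then wigner_parameter M (X (lab e)) else 1)"
            proof (rule pair_moment[OF e(1) e'(1) lab _ _ real_parameter[OF e(1)]])
              show "{?r e', ?c e'} = {?r e, ?c e}" using mem(1) by (simp add: edge_group_def)
              show "?r e \<noteq> ?c e" using ne' nonneg tar_src[OF e(1)] by (simp add: eq_nat_nat_iff)
            qed
            moreover have "group_moment ?rb ?cb {e, e'} = (if ?rb e' = ?rb e then wigner_parameter M (X (lab e)) else 1)"
            proof (rule pair_moment[OF e(1) e'(1) lab _ _ real_parameter[OF e(1)]])
              show "{?rb e', ?cb e'} = {?rb e, ?cb e}" using mem(2) by (simp add: edge_group_def)
              show "?rb e \<noteq> ?cb e" using ne nonneg tar_src[OF e(1)] by (simp add: eq_nat_nat_iff)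
            qed
            ultimately show ?thesis using same e'(2) by simp
          qed
        qed
        then show ?thesis
          unfolding moment_at_groups[OF \<phi>1] moment_at_groups[OF \<phi>\<^sub>0] groups by (rule prod.cong[OF refl])
      qed
      have "term_sum P n = of_real (CP.pattern_sum n) * (of_real \<kappa> * moment_at \<phi>\<^sub>0)" for n
      proof -
        have "(\<Sum>\<phi>\<in>?S n. of_real (\<kappa> * ?W n \<phi>) * moment_at \<phi>) =
            (\<Sum>\<phi>\<in>?S n. of_real (?W n \<phi>) * (of_real \<kappa> * moment_at \<phi>\<^sub>0))"
          by (intro sum.cong refl) (simp only: const of_real_mult mult_ac)
        then show ?thesis
          unfolding split S CP.pattern_sum_def
          by (simp only: sum_distrib_right[symmetric] of_real_sum[symmetric] of_real_divide of_real_of_nat_eq times_divide_eq_left)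
      qed
      then have "term_sum P = (\<lambda>n. of_real (CP.pattern_sum n) * (of_real \<kappa> * moment_at \<phi>\<^sub>0))"
        by (rule ext)
      moreover obtain l where "CP.pattern_sum \<longlonglongrightarrow> l"
        using CP.pattern_sum_convergent[OF tree] by (auto simp: convergent_def)
      then have "(\<lambda>n. of_real (CP.pattern_sum n) * (of_real \<kappa> * moment_at \<phi>\<^sub>0)) \<longlonglongrightarrow>
          of_real l * (of_real \<kappa> * moment_at \<phi>\<^sub>0)"
        by (intro tendsto_intros)
      ultimately show ?thesis by (auto simp: convergent_def)
    qed
  qed
qed

text \<open>A pattern is a subset of a finite set that does not depend on n, so finitely many
  patterns cover all maps of every size.\<close>

lemma moment_sum_convergent:
  "convergent (\<lambda>n. (\<Sum>\<phi>\<in>V \<rightarrow>\<^sub>E {0..<int n}. of_real (\<Prod>e\<in>E. wt e n \<phi>) * moment_at \<phi>) / of_nat n)"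
proof -
  let ?P = "Pow (V \<times> V \<times> {- int D..int D})"
  have "(\<Sum>\<phi>\<in>V \<rightarrow>\<^sub>E {0..<int n}. of_real (\<Prod>e\<in>E. wt e n \<phi>) * moment_at \<phi>) / of_nat n =
      (\<Sum>P\<in>?P. term_sum P n)" for n
  proof -
    have "(\<Sum>P\<in>?P. \<Sum>\<phi>\<in>{\<phi> \<in> V \<rightarrow>\<^sub>E {0..<int n}. pattern V D \<phi> = P}. of_real (\<Prod>e\<in>E. wt e n \<phi>) * moment_at \<phi>) =
        (\<Sum>\<phi>\<in>V \<rightarrow>\<^sub>E {0..<int n}. of_real (\<Prod>e\<in>E. wt e n \<phi>) * moment_at \<phi>)"
      by (rule sum.group) (use finite_V pattern_subset in \<open>auto simp: finite_PiE\<close>)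
    then show ?thesis unfolding term_sum_def sum_divide_distrib[symmetric] by (simp only:)
  qed
  moreover have "convergent (\<lambda>n. \<Sum>P\<in>?P. term_sum P n)"
    by (intro convergent_sum term_sum_convergent)
  ultimately show ?thesis by simp
qed

end

section \<open>Reduction of test graphs to sums over bands\<close>

lemma connected_crossing:
  assumes "Digraph_Component.connected G" "R \<subseteq> verts G" "R \<noteq> {}" "R \<noteq> verts G"
  shows "\<exists>e\<in>arcs G. head G e \<in> R \<and> tail G e \<notin> R \<or> head G e \<notin> R \<and> tail G e \<in> R"
proof (rule ccontr)
  assume no: "\<not> ?thesis"
  obtain u v where uv: "u \<in> R" "v \<in> verts G - R" using assms(2-4) by blast
  have "(u, v) \<in> rtrancl_on (verts G) ((arcs_ends G)\<^sup>s)"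
    using assms(1,2) uv unfolding connected_conv by blast
  then have "v \<in> R"
  proof (induction rule: rtrancl_on_induct)
    case base
    show ?case by (rule uv(1))
  next
    case (step x y)
    then show ?case using no by (auto simp: symcl_def arcs_ends_conv)
  qed
  with uv(2) show False by simp
qed

context band_model
begin

text \<open>The matrices are Hermitian: the scale is real, the band is symmetric and the diagonal
  entries are real. A starred factor therefore equals the unstarred one, and deterministic weights
  can be pulled out of the expectation.\<close>

lemma graph_moment_eq:
  assumes E: "arcs (graph T) = E" and V: "verts (graph T) = V" and lab: "label T = lab"
    and ends: "head (graph T) = tar" "tail (graph T) = src"
    and A: "\<And>i \<omega>. i \<in> lab ` E \<Longrightarrow> A i \<omega> = Matrix.mat n n (\<lambda>(j, k).
      of_real (a i n) * of_bool (\<bar>int j - int k\<bar> \<le> int (w i n)) * entry i j k \<omega>)"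
  shows "graph_moment M n A T =
    (\<Sum>\<phi>\<in>V \<rightarrow>\<^sub>E {0..<int n}. of_real (\<Prod>e\<in>E. wt e n \<phi>) * moment_at \<phi>) / of_nat n"
proof -
  let ?ent = "\<lambda>\<phi> e. entry (lab e) (\<phi> (tar e)) (\<phi> (src e))"
  let ?w = "\<lambda>\<phi> e. a (lab e) n * of_bool (\<bar>int (\<phi> (tar e)) - int (\<phi> (src e))\<bar> \<le> int (w (lab e) n))"
  \<comment> \<open>Real diagonal entries are available only on the sample space, so the identity is
    stated there.\<close>
  have hermitian: "cnj (entry i k j \<omega>) = entry i j k \<omega>" if "i \<in> I" "\<omega> \<in> space M" for i j k \<omega>
  proof (cases "j = k")
    case True
    have "X i j j \<omega> \<in> \<real>" using wigner[OF that(1)] that(2) unfolding wigner_array_def by blast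
    with True show ?thesis by (simp add: entry_def Reals_cnj_iff)
  qed (auto simp: entry_def)
  have factor: "(if starred T e then mat_adjoint (A (label T e) \<omega>) else A (label T e) \<omega>) $$
      (\<phi> (head (graph T) e), \<phi> (tail (graph T) e)) = of_real (?w \<phi> e) * ?ent \<phi> e \<omega>"
    if "\<omega> \<in> space M" "\<phi> \<in> V \<rightarrow>\<^sub>E {..<n}" "e \<in> E" for \<omega> \<phi> e
  proof -
    have lt: "\<phi> (tar e) < n" "\<phi> (src e) < n"
      using that(2) tar_src[OF that(3)] by (auto simp: PiE_def Pi_def)
    have Ae: "A (lab e) \<omega> = Matrix.mat n n (\<lambda>(j, k).
      of_real (a (lab e) n) * of_bool (\<bar>int j - int k\<bar> \<le> int (w (lab e) n)) * entry (lab e) j k \<omega>)"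
      using A that(3) by blast
    have adj: "mat_adjoint B $$ (j, k) = cnj (B $$ (k, j))" if "B \<in> carrier_mat n n" "j < n" "k < n" for B j k
      using that by (simp add: mat_adjoint_def mat_of_rows_def conjugate_complex_def)
    show ?thesis
    proof (cases "starred T e")
      case True
      then show ?thesis
        unfolding lab ends
        using lt hermitian[OF lab_I[OF that(3)] that(1)]
        by (simp add: adj Ae abs_minus_commute del: mat_adjoint_def)
    next
      case False
      then show ?thesis unfolding lab ends using lt by (simp add: Ae)
    qed
  qed
  have "graph_moment M n A T = expectation (\<lambda>\<omega>. 1 / of_nat n *
      (\<Sum>\<phi>\<in>V \<rightarrow>\<^sub>E {..<n}. of_real (\<Prod>e\<in>E. ?w \<phi> e) * (\<Prod>e\<in>E. ?ent \<phi> e \<omega>)))"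
    unfolding graph_moment_def E V
  proof (intro Bochner_Integration.integral_cong arg_cong2[where f = "(*)"] sum.cong refl)
    fix \<omega> \<phi> assume "\<omega> \<in> space M" "\<phi> \<in> V \<rightarrow>\<^sub>E {..<n}"
    then show "(\<Prod>e\<in>E. (if starred T e then mat_adjoint (A (label T e) \<omega>) else A (label T e) \<omega>) $$
      (\<phi> (head (graph T) e), \<phi> (tail (graph T) e))) = of_real (\<Prod>e\<in>E. ?w \<phi> e) * (\<Prod>e\<in>E. ?ent \<phi> e \<omega>)"
      by (simp only: of_real_prod prod.distrib[symmetric]) (rule prod.cong[OF refl factor])
  qed
  also have "\<dots> = 1 / of_nat n * (\<Sum>\<phi>\<in>V \<rightarrow>\<^sub>E {..<n}. of_real (\<Prod>e\<in>E. ?w \<phi> e) *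
      mixed_moment (\<lambda>e. \<phi> (tar e)) (\<lambda>e. \<phi> (src e)))"
    unfolding mixed_moment_def
    by (subst integral_mult_right_zero, subst Bochner_Integration.integral_sum)
      (intro integrable_mult_right entry_prod_integrable, simp only: integral_mult_right_zero)
  also have "(\<Sum>\<phi>\<in>V \<rightarrow>\<^sub>E {..<n}. of_real (\<Prod>e\<in>E. ?w \<phi> e) *
      mixed_moment (\<lambda>e. \<phi> (tar e)) (\<lambda>e. \<phi> (src e))) =
      (\<Sum>\<phi>\<in>V \<rightarrow>\<^sub>E {0..<int n}. of_real (\<Prod>e\<in>E. wt e n \<phi>) * moment_at \<phi>)"
  proof (rule sum.reindex_bij_witness[where
        i = "\<lambda>\<phi>. restrict (nat \<circ> \<phi>) V" and j = "\<lambda>\<phi>. restrict (int \<circ> \<phi>) V"])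
    fix \<phi> assume \<phi>: "\<phi> \<in> V \<rightarrow>\<^sub>E {..<n}"
    show "restrict (nat \<circ> restrict (int \<circ> \<phi>) V) V = \<phi>"
    proof
      fix x show "restrict (nat \<circ> restrict (int \<circ> \<phi>) V) V x = \<phi> x"
        using \<phi> by (cases "x \<in> V") (auto simp: PiE_def extensional_def)
    qed
    show "restrict (int \<circ> \<phi>) V \<in> V \<rightarrow>\<^sub>E {0..<int n}"
      using \<phi> by (auto simp: PiE_def Pi_def)
    have "(\<Prod>e\<in>E. wt e n (restrict (int \<circ> \<phi>) V)) = (\<Prod>e\<in>E. ?w \<phi> e)"
      by (intro prod.cong refl) (use tar_src in \<open>simp add: edge_weight_def\<close>)
    moreover have "moment_at (restrict (int \<circ> \<phi>) V) = mixed_moment (\<lambda>e. \<phi> (tar e)) (\<lambda>e. \<phi> (src e))"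
      unfolding moment_at_def mixed_moment_def
      by (intro Bochner_Integration.integral_cong prod.cong refl) (use tar_src in simp)
    ultimately show "of_real (\<Prod>e\<in>E. wt e n (restrict (int \<circ> \<phi>) V)) * moment_at (restrict (int \<circ> \<phi>) V) =
        of_real (\<Prod>e\<in>E. ?w \<phi> e) * mixed_moment (\<lambda>e. \<phi> (tar e)) (\<lambda>e. \<phi> (src e))"
      by (simp only:)
  next
    fix \<phi> assume \<phi>: "\<phi> \<in> V \<rightarrow>\<^sub>E {0..<int n}"
    show "restrict (int \<circ> restrict (nat \<circ> \<phi>) V) V = \<phi>"
    proof
      fix x show "restrict (int \<circ> restrict (nat \<circ> \<phi>) V) V x = \<phi> x"
        using \<phi> by (cases "x \<in> V") (auto simp: PiE_def Pi_def extensional_def)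
    qed
    show "restrict (nat \<circ> \<phi>) V \<in> V \<rightarrow>\<^sub>E {..<n}"
      using \<phi> by (auto simp: PiE_def Pi_def nat_less_iff)
  qed
  finally show ?thesis by simp
qed

end

text \<open>Constancy of the fixed scales and the form of the matrices are asked only for labels of
  \<open>T\<close>. The lemma thus also applies to families that are described on a part of
  \<open>I\<close>.\<close>

lemma graph_moment_convergent:
  fixes X :: "'i \<Rightarrow> nat \<Rightarrow> nat \<Rightarrow> 'w \<Rightarrow> complex"
  assumes "growing_scales Q a w Gr" "wigner_family M I X" and T: "T \<in> star_test_graphs I"
    and fixed: "\<And>i n. i \<in> label T ` arcs (graph T) \<Longrightarrow> i \<notin> Gr \<Longrightarrow> a i n = a i 0 \<and> w i n = w i 0"
    and real: "\<And>i. i \<in> I \<Longrightarrow> wigner_parameter M (X i) \<in> \<real>"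
    and A: "\<And>n i \<omega>. i \<in> label T ` arcs (graph T) \<Longrightarrow> A n i \<omega> = Matrix.mat n n (\<lambda>(j, k).
      of_real (a i n) * of_bool (\<bar>int j - int k\<bar> \<le> int (w i n)) * wigner_family.entry X i j k \<omega>)"
  shows "convergent (\<lambda>n. graph_moment M n (A n) T)"
proof -
  interpret growing_scales Q a w Gr by fact
  interpret wigner_family M I X by fact
  from T interpret G: fin_digraph "graph T" by (simp add: star_test_graphs_def)
  from T have con: "Digraph_Component.connected (graph T)" and lab: "label T ` arcs (graph T) \<subseteq> I"
    by (simp_all add: star_test_graphs_def)
  \<comment> \<open>The sum of the widths at index 0 over all edges is a crude bound
    \<open>D\<close> for the fixed widths, finite because \<open>T\<close> has finitely many
    edges.\<close>
  interpret B: band_model Q a w Gr M I X "arcs (graph T)" "label T" "verts (graph T)"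
    "head (graph T)" "tail (graph T)" "\<Sum>e\<in>arcs (graph T). w (label T e) 0"
  proof unfold_locales
    show "verts (graph T) \<noteq> {}" using con unfolding connected_conv by blast
    fix e n assume e: "e \<in> arcs (graph T)" "label T e \<notin> Gr"
    have "w (label T e) 0 \<le> (\<Sum>e\<in>arcs (graph T). w (label T e) 0)"
      by (rule member_le_sum[of e _ "\<lambda>e. w (label T e) 0"]) (use e in auto)
    with fixed[of "label T e" n] e show "a (label T e) n = a (label T e) 0 \<and> w (label T e) n = w (label T e) 0 \<and>
        w (label T e) 0 \<le> (\<Sum>e\<in>arcs (graph T). w (label T e) 0)" by auto
  qed (use connected_crossing[OF con] lab real in auto)
  have "graph_moment M n (A n) T = (\<Sum>\<phi>\<in>verts (graph T) \<rightarrow>\<^sub>E {0..<int n}.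
      of_real (\<Prod>e\<in>arcs (graph T). B.wt e n \<phi>) * B.moment_at \<phi>) / of_nat n" for n
    by (rule B.graph_moment_eq) (use A in auto)
  with B.moment_sum_convergent show ?thesis by simp
qed

section \<open>Traffic convergence of band matrices\<close>

lemma growing_scales_profile:
  assumes avg: "\<And>i g G d. i \<in> Gr \<Longrightarrow> has_profile g G \<Longrightarrow> \<exists>G'. has_profile (band_average (a i) (w i) d g) G'"
    and a: "\<And>i n. i \<in> Gr \<Longrightarrow> 0 \<le> a i n" "\<And>i. i \<in> Gr \<Longrightarrow> a i \<longlonglongrightarrow> 0"
  shows "growing_scales (\<lambda>g. \<exists>G. has_profile g G) a w Gr"
proof
  show "convergent (\<lambda>n. (\<Sum>x\<in>{0..<int n}. g n x) / real n)" if "\<exists>G. has_profile g G" for g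
    using that has_profile_average unfolding convergent_def by blast
qed (use assms has_profile_const has_profile_inside has_profile_mult in blast)+

text \<open>Averages that switch with n between different bands have a profile only if all of them
  produce the same limit. Constant profiles that every band reproduces ensure this.\<close>

lemma growing_scales_constant_profile:
  assumes avg: "\<And>i g z d. i \<in> Gr \<Longrightarrow> has_profile g (\<lambda>_. z) \<Longrightarrow> has_profile (band_average (a i) (w i) d g) (\<lambda>_. z)"
    and a: "\<And>i n. i \<in> Gr \<Longrightarrow> 0 \<le> a i n" "\<And>i. i \<in> Gr \<Longrightarrow> a i \<longlonglongrightarrow> 0"
  shows "growing_scales (\<lambda>g. \<exists>z. has_profile g (\<lambda>_. z)) a w Gr"
proof
  show "convergent (\<lambda>n. (\<Sum>x\<in>{0..<int n}. g n x) / real n)" if "\<exists>z. has_profile g (\<lambda>_. z)" for g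
    using that has_profile_average unfolding convergent_def by blast
  show "\<exists>z. has_profile (\<lambda>n x. g n x * h n x) (\<lambda>_. z)"
    if "\<exists>z. has_profile g (\<lambda>_. z)" "\<exists>z. has_profile h (\<lambda>_. z)" for g h
  proof -
    from that obtain y z where "has_profile g (\<lambda>_. y)" "has_profile h (\<lambda>_. z)" by auto
    from has_profile_mult[OF this] show ?thesis by blast
  qed
  show "\<exists>z. has_profile (\<lambda>_ _. 1) (\<lambda>_. z)" using has_profile_const by blast
  show "\<exists>z. has_profile (\<lambda>n x. of_bool (0 \<le> x + d \<and> x + d < int n)) (\<lambda>_. z)" for d
    using has_profile_inside by blast
  show "\<exists>z. has_profile (band_average (a i) (w i) d g) (\<lambda>_. z)"
    if "i \<in> Gr" "\<exists>z. has_profile g (\<lambda>_. z)" for i g d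
    using that avg by blast
qed (use a in auto)

lemma has_profile_interleave:
  assumes "has_profile g G" "has_profile h G"
  shows "has_profile (\<lambda>n x. if s n then g n x else h n x) G"
proof -
  obtain B C where B: "\<And>n x. \<bar>g n x\<bar> \<le> B" and C: "\<And>n x. \<bar>h n x\<bar> \<le> C"
    using assms by (auto simp: has_profile_def)
  have "\<bar>if s n then g n x else h n x\<bar> \<le> max B C" for n x
    using B[of n x] C[of n x] by auto
  moreover have "(\<lambda>n. if s n then g n (k n) else h n (k n)) \<longlonglongrightarrow> G x"
    if "x \<in> {0<..<1}" "(\<lambda>n. real_of_int (k n) / real n) \<longlonglongrightarrow> x" for x k
  proof (rule topological_tendstoI)
    fix S assume S: "open S" "G x \<in> S"
    have "\<forall>\<^sub>F n in sequentially. g n (k n) \<in> S" "\<forall>\<^sub>F n in sequentially. h n (k n) \<in> S"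
      using that by (intro topological_tendstoD[OF has_profileD[OF assms(1)] S]
          topological_tendstoD[OF has_profileD[OF assms(2)] S]; simp)+
    then show "\<forall>\<^sub>F n in sequentially. (if s n then g n (k n) else h n (k n)) \<in> S"
      by eventually_elim simp
  qed
  ultimately show ?thesis unfolding has_profile_def by blast
qed

lemma slow_scale_tendsto:
  assumes "slow_growth b"
  shows "(\<lambda>n. 1 / sqrt (2 * real (b n))) \<longlonglongrightarrow> 0"
proof -
  have "filterlim (\<lambda>n. real (b n)) at_top sequentially"
    using assms filterlim_compose[OF filterlim_real_sequentially] by (auto simp: slow_growth_def)
  then have "filterlim (\<lambda>n. 2 * real (b n)) at_top sequentially"
    by (rule filterlim_tendsto_pos_mult_at_top[OF tendsto_const, rotated]) simp
  then have "filterlim (\<lambda>n. sqrt (2 * real (b n))) at_top sequentially"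
    by (rule filterlim_compose[OF sqrt_at_top])
  then show ?thesis
    by (intro tendsto_divide_0[OF tendsto_const] filterlim_at_top_imp_at_infinity)
qed

lemma proportional_scale_tendsto:
  "(\<lambda>n. 1 / (sqrt v * sqrt (real n))) \<longlonglongrightarrow> 0"
proof -
  have "filterlim (\<lambda>n. sqrt (real n)) at_top sequentially"
    by (rule filterlim_compose[OF sqrt_at_top filterlim_real_sequentially])
  then have "(\<lambda>n. 1 / sqrt v * (1 / sqrt (real n))) \<longlonglongrightarrow> 1 / sqrt v * 0"
    by (intro tendsto_mult tendsto_const tendsto_divide_0[OF tendsto_const] filterlim_at_top_imp_at_infinity)
  then show ?thesis by simp
qed

section \<open>Band matrices and Wigner matrices in a common form\<close>

context wigner_family
begin

lemma band_matrix_entries: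
  "complex_of_real z \<cdot>\<^sub>m band_matrix b (X i) n \<omega> = Matrix.mat n n (\<lambda>(j, k).
     of_real z * of_bool (\<bar>int j - int k\<bar> \<le> int b) * entry i j k \<omega>)"
  by (rule eq_matI) (auto simp: band_matrix_def wigner_matrix_def entry_def)

text \<open>A Wigner matrix is its own band matrix of width n. These widths grow with full
  proportion, which places \<open>W\<close> in the same scheme as the bands.\<close>

lemma normalized_wigner_entries:
  "normalized_wigner (X i) n \<omega> = Matrix.mat n n (\<lambda>(j, k).
     of_real (1 / sqrt (real n)) * of_bool (\<bar>int j - int k\<bar> \<le> int n) * entry i j k \<omega>)"
  by (rule eq_matI) (auto simp: normalized_wigner_def wigner_matrix_def entry_def)

end

lemma traffic_distribution_tendsto:
  assumes "\<And>T. T \<in> Poly_Mapping.keys t \<Longrightarrow> (\<lambda>n. graph_moment M n (A n) T) \<longlonglongrightarrow> L T"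
  shows "limiting_traffic_distribution M A t = (\<Sum>T\<in>Poly_Mapping.keys t. Poly_Mapping.lookup t T * L T)"
  unfolding limiting_traffic_distribution_def traffic_distribution_def
  by (intro limI tendsto_sum tendsto_mult tendsto_const assms)

lemma star_test_graphs_mono: "I \<subseteq> J \<Longrightarrow> star_test_graphs I \<subseteq> star_test_graphs J"
  by (auto simp: star_test_graphs_def)

theorem theorem1p5:
  fixes M :: "'w measure"
    and I I1 I2 I3 I4 :: "'i set"
    and X :: "'i \<Rightarrow> nat \<Rightarrow> nat \<Rightarrow> 'w \<Rightarrow> complex"
    and \<beta> c :: "'i \<Rightarrow> real"
    and b :: "'i \<Rightarrow> nat \<Rightarrow> nat"
    and b_fixed :: "'i \<Rightarrow> nat"
    and \<Theta> W :: "nat \<Rightarrow> 'i \<Rightarrow> 'w \<Rightarrow> complex mat"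
  assumes "prob_space M"
    and "\<And>i. i \<in> I \<Longrightarrow> wigner_array M (X i)"
    and "\<And>i. i \<in> I \<Longrightarrow> finite_moment M (X i)"
    and "\<And>i. i \<in> I \<Longrightarrow> wigner_parameter M (X i) = complex_of_real (\<beta> i)"
    and "independent_arrays M I X"
    and "I = I1 \<union> I2 \<union> I3 \<union> I4"
    and "I1 \<inter> I2 = {}" "I1 \<inter> I3 = {}" "I1 \<inter> I4 = {}"
        "I2 \<inter> I3 = {}" "I2 \<inter> I4 = {}" "I3 \<inter> I4 = {}"
    and "\<And>i. i \<in> I1 \<Longrightarrow> slow_growth (b i)"
    and "\<And>i. i \<in> I2 \<Longrightarrow> proportional_growth (b i) (c i) \<and> c i < 1"
    and "\<And>i. i \<in> I3 \<Longrightarrow> proportional_growth (b i) (c i) \<and> c i = 1"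
    and "\<And>i n. i \<in> I4 \<Longrightarrow> n \<ge> 1 \<Longrightarrow> b i n = b_fixed i"
    and "\<And>i n. i \<in> I1 \<Longrightarrow> \<Theta> n i = slow_band (b i) (X i) n"
    and "\<And>i n. i \<in> I2 \<union> I3 \<Longrightarrow> \<Theta> n i = proportional_band (b i) (c i) (X i) n"
    and "\<And>i n. i \<in> I4 \<Longrightarrow> \<Theta> n i = fixed_band (b_fixed i) (X i) n"
    and "\<And>i n. i \<in> I \<Longrightarrow> W n i = normalized_wigner (X i) n"
  shows "converges_in_traffic M I \<Theta> \<and>
         converges_in_traffic M (I1 \<union> I3) \<Theta> \<and>
         converges_in_traffic M (I1 \<union> I3) W \<and>
         (\<forall>t. Poly_Mapping.keys t \<subseteq> star_test_graphs (I1 \<union> I3) \<longrightarrow>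
            limiting_traffic_distribution M \<Theta> t = limiting_traffic_distribution M W t)"
proof -
  note slow = assms(13) and proper = assms(14) and full = assms(15)
    and \<Theta>1 = assms(17) and \<Theta>23 = assms(18) and \<Theta>4 = assms(19) and W = assms(20)
  have fam: "wigner_family M I X"
    using assms(1-3,5) by (simp add: wigner_family_def wigner_family_axioms_def)
  interpret F: wigner_family M I X by (rule fam)
  have real: "wigner_parameter M (X i) \<in> \<real>" if "i \<in> I" for i using assms(4)[OF that] by simp
  have growth: "proportional_growth (b i) (c i)" if "i \<in> I2 \<union> I3" for i
    using that proper full by blast
  have sub: "I1 \<union> I3 \<subseteq> I" using assms(6) by blast
  define a where "a i n = (if i \<in> I1 then 1 / sqrt (2 * real (b i n)) else if i \<in> I4 then 1 / sqrt (2 * real (b_fixed i) + 1)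
    else 1 / (sqrt (2 * c i - (c i)\<^sup>2) * sqrt (real n)))" for i n
  \<comment> \<open>On \<open>I4\<close> the width is taken from \<open>b_fixed\<close>: constancy
    is required from index 0 on, where \<open>b i 0\<close> is unconstrained.\<close>
  define w where "w i n = (if i \<in> I4 then b_fixed i else b i n)" for i n
  have a1: "a i = (\<lambda>n. 1 / sqrt (2 * real (b i n)))" "w i = b i" if "i \<in> I1" for i
    using that assms(9) by (auto simp: a_def w_def fun_eq_iff)
  have a23: "a i = (\<lambda>n. 1 / (sqrt (2 * c i - (c i)\<^sup>2) * sqrt (real n)))" "w i = b i" if "i \<in> I2 \<union> I3" for i
    using that assms(7,8,11,12) by (auto simp: a_def w_def fun_eq_iff)
  have a4: "a i = (\<lambda>n. 1 / sqrt (2 * real (b_fixed i) + 1))" "w i = (\<lambda>n. b_fixed i)" if "i \<in> I4" for i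
    using that assms(9) by (auto simp: a_def w_def fun_eq_iff)
  have c3: "a i = (\<lambda>n. 1 / sqrt (real n))" if "i \<in> I3" for i
    using a23(1)[of i] full[OF that] that by auto
  have scale: "0 \<le> a i n" "a i \<longlonglongrightarrow> 0" if i: "i \<in> I1 \<union> I2 \<union> I3" for i n
  proof -
    consider "i \<in> I1" | "i \<in> I2 \<union> I3" using i by blast
    then have "0 \<le> a i n \<and> a i \<longlonglongrightarrow> 0"
    proof cases
      case 1
      then show ?thesis unfolding a1[OF 1] using slow_scale_tendsto[OF slow[OF 1]] by simp
    next
      case 2
      have "0 < 2 * c i - (c i)\<^sup>2"
        using growth[OF 2] unfolding proportional_growth_def by (intro proportional_variance_pos) auto
      then show ?thesis unfolding a23[OF 2] using proportional_scale_tendsto by simp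
    qed
    then show "0 \<le> a i n" "a i \<longlonglongrightarrow> 0" by auto
  qed
  have \<Theta>: "\<Theta> n i \<omega> = Matrix.mat n n (\<lambda>(j, k).
      of_real (a i n) * of_bool (\<bar>int j - int k\<bar> \<le> int (w i n)) * F.entry i j k \<omega>)" if "i \<in> I" for n i \<omega>
  proof -
    have "\<Theta> n i \<omega> = complex_of_real (a i n) \<cdot>\<^sub>m band_matrix (w i n) (X i) n \<omega>"
      using that assms(6) a1[of i] a23[of i] a4[of i] \<Theta>1[of i n] \<Theta>23[of i n] \<Theta>4[of i n]
      by (auto simp: slow_band_def proportional_band_def fixed_band_def)
    then show ?thesis by (simp only: F.band_matrix_entries)
  qed
  have conv\<Theta>: "convergent (\<lambda>n. graph_moment M n (\<Theta> n) T)" if T: "T \<in> star_test_graphs I" for T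
  proof (rule graph_moment_convergent[OF growing_scales_profile fam T])
    show "\<exists>G'. has_profile (band_average (a i) (w i) d g) G'" if "i \<in> I1 \<union> I2 \<union> I3" "has_profile g G" for i g G d
    proof (cases "i \<in> I1")
      case True
      with has_profile_slow_average[OF that(2) slow] show ?thesis unfolding a1[OF True] by blast
    next
      case False
      with that have i: "i \<in> I2 \<union> I3" by blast
      with has_profile_proportional_average[OF that(2) growth] show ?thesis unfolding a23[OF i] by blast
    qed
    fix i n assume i: "i \<in> label T ` arcs (graph T)"
    then have "i \<in> I" using T by (auto simp: star_test_graphs_def)
    then show "\<Theta> n i \<omega> = Matrix.mat n n (\<lambda>(j, k).
      of_real (a i n) * of_bool (\<bar>int j - int k\<bar> \<le> int (w i n)) * F.entry i j k \<omega>)" for \<omega> by (rule \<Theta>)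
    assume "i \<notin> I1 \<union> I2 \<union> I3"
    with \<open>i \<in> I\<close> have "i \<in> I4" using assms(6) by blast
    from a4[OF this] show "a i n = a i 0 \<and> w i n = w i 0" by simp
  qed (use scale real in blast)+
  \<comment> \<open>The switch \<open>s\<close> is arbitrary: a constant switch gives the
    convergence of \<open>W\<close> alone, an alternating one compares the limits.\<close>
  have convmix: "convergent (\<lambda>n. graph_moment M n (if s n then \<Theta> n else W n) T)"
    if T: "T \<in> star_test_graphs (I1 \<union> I3)" for T s
  proof -
    define a' where "a' i n = (if s n then a i n else 1 / sqrt (real n))" for i n
    define w' where "w' i n = (if s n then w i n else n)" for i n
    have TI: "T \<in> star_test_graphs I" using T star_test_graphs_mono[OF sub] by blast
    have sqrt_n: "(\<lambda>n. 1 / sqrt (real n)) \<longlonglongrightarrow> 0" using proportional_scale_tendsto[of 1] by simp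
    have growing: "growing_scales (\<lambda>g. \<exists>z. has_profile g (\<lambda>_. z)) a' w' (I1 \<union> I3)"
    proof (rule growing_scales_constant_profile)
      fix i g z d assume i: "i \<in> I1 \<union> I3" and g: "has_profile g (\<lambda>_. z)"
      have "has_profile (band_average (a i) (w i) d g) (\<lambda>_. z)"
      proof (cases "i \<in> I1")
        case True
        from has_profile_slow_average[OF g slow[OF True]] show ?thesis unfolding a1[OF True] .
      next
        case False
        with i have i3: "i \<in> I3" by blast
        then have "proportional_growth (b i) 1" using full by metis
        from has_profile_full_proportion_average[OF g this] i3 show ?thesis
          unfolding c3[OF i3] using a23(2)[of i] by simp
      qed
      moreover have "proportional_growth (\<lambda>n. n) 1"
        unfolding proportional_growth_def
        by (auto intro!: tendsto_eventually eventually_mono[OF eventually_gt_at_top[of 0]])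
      from has_profile_full_proportion_average[OF g this]
      have "has_profile (band_average (\<lambda>n. 1 / sqrt (real n)) (\<lambda>n. n) d g) (\<lambda>_. z)" .
      ultimately have "has_profile (\<lambda>n x. if s n then band_average (a i) (w i) d g n x
        else band_average (\<lambda>n. 1 / sqrt (real n)) (\<lambda>n. n) d g n x) (\<lambda>_. z)"
        by (rule has_profile_interleave)
      also have "(\<lambda>n x. if s n then band_average (a i) (w i) d g n x
        else band_average (\<lambda>n. 1 / sqrt (real n)) (\<lambda>n. n) d g n x) = band_average (a' i) (w' i) d g"
        by (intro ext) (simp add: band_average_def a'_def w'_def)
      finally show "has_profile (band_average (a' i) (w' i) d g) (\<lambda>_. z)" .
    next
      fix i assume i: "i \<in> I1 \<union> I3"
      show "0 \<le> a' i n" for n using scale(1)[of i n] i by (auto simp: a'_def)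
      show "a' i \<longlonglongrightarrow> 0"
      proof (rule topological_tendstoI)
        fix S :: "real set" assume "open S" "0 \<in> S"
        with scale(2)[of i] sqrt_n i have "\<forall>\<^sub>F n in sequentially. a i n \<in> S"
          "\<forall>\<^sub>F n in sequentially. 1 / sqrt (real n) \<in> S"
          by (auto dest: topological_tendstoD)
        then show "\<forall>\<^sub>F n in sequentially. a' i n \<in> S" by eventually_elim (simp add: a'_def)
      qed
    qed
    show ?thesis
    proof (rule graph_moment_convergent[OF growing fam TI])
      fix i n \<omega> assume "i \<in> label T ` arcs (graph T)"
      then have i: "i \<in> I1 \<union> I3" using T by (auto simp: star_test_graphs_def)
      with sub have "i \<in> I" by blast
      then show "(if s n then \<Theta> n else W n) i \<omega> = Matrix.mat n n (\<lambda>(j, k).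
        of_real (a' i n) * of_bool (\<bar>int j - int k\<bar> \<le> int (w' i n)) * F.entry i j k \<omega>)"
        using \<Theta>[of i n \<omega>] W[of i n] F.normalized_wigner_entries[of i n \<omega>] by (simp add: a'_def w'_def)
      \<comment> \<open>This case is void, as every label of \<open>T\<close> has a growing band
        width.\<close>
      show "a' i n = a' i 0 \<and> w' i n = w' i 0" if "i \<notin> I1 \<union> I3" using that i by blast
    qed (rule real)
  qed
  have convW: "convergent (\<lambda>n. graph_moment M n (W n) T)" if "T \<in> star_test_graphs (I1 \<union> I3)" for T
    using convmix[OF that, of "\<lambda>_. False"] by simp
  \<comment> \<open>The moments of the family that equals \<open>\<Theta>\<close> at even and \<open>W\<close> at odd indices converge too,
    so \<open>\<Theta>\<close> and \<open>W\<close> have the same limit.\<close>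
  have same: "lim (\<lambda>n. graph_moment M n (\<Theta> n) T) = lim (\<lambda>n. graph_moment M n (W n) T)"
    if T: "T \<in> star_test_graphs (I1 \<union> I3)" for T
  proof -
    let ?g = "\<lambda>A n. graph_moment M n (A n) T"
    let ?mix = "\<lambda>n. if even n then \<Theta> n else W n"
    have TI: "T \<in> star_test_graphs I" using T star_test_graphs_mono[OF sub] by blast
    obtain l where l: "?g ?mix \<longlonglongrightarrow> l" using convmix[OF T, of even] by (auto simp: convergent_def)
    have "strict_mono (\<lambda>n::nat. 2 * n)" "strict_mono (\<lambda>n::nat. 2 * n + 1)" by (auto simp: strict_mono_def)
    note sm = this
    have \<Theta>l: "?g \<Theta> \<longlonglongrightarrow> lim (?g \<Theta>)" and Wl: "?g W \<longlonglongrightarrow> lim (?g W)"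
      using conv\<Theta>[OF TI] convW[OF T] by (simp_all add: convergent_LIMSEQ_iff)
    have "(\<lambda>n. ?g \<Theta> (2 * n)) \<longlonglongrightarrow> l" "(\<lambda>n. ?g W (2 * n + 1)) \<longlonglongrightarrow> l"
      using LIMSEQ_subseq_LIMSEQ[OF l sm(1)] LIMSEQ_subseq_LIMSEQ[OF l sm(2)] by (simp_all add: o_def)
    note mixed = this
    have "(\<lambda>n. ?g \<Theta> (2 * n)) \<longlonglongrightarrow> lim (?g \<Theta>)" "(\<lambda>n. ?g W (2 * n + 1)) \<longlonglongrightarrow> lim (?g W)"
      using LIMSEQ_subseq_LIMSEQ[OF \<Theta>l sm(1)] LIMSEQ_subseq_LIMSEQ[OF Wl sm(2)] by (simp_all add: o_def)
    with LIMSEQ_unique[OF mixed(1)] LIMSEQ_unique[OF mixed(2)] show ?thesis by simp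
  qed
  have "limiting_traffic_distribution M \<Theta> t = limiting_traffic_distribution M W t"
    if t: "Poly_Mapping.keys t \<subseteq> star_test_graphs (I1 \<union> I3)" for t
  proof -
    have "limiting_traffic_distribution M \<Theta> t =
        (\<Sum>T\<in>Poly_Mapping.keys t. Poly_Mapping.lookup t T * lim (\<lambda>n. graph_moment M n (\<Theta> n) T))"
      by (rule traffic_distribution_tendsto)
        (use t conv\<Theta> star_test_graphs_mono[OF sub] in \<open>auto simp: convergent_LIMSEQ_iff[symmetric]\<close>)
    also have "\<dots> = (\<Sum>T\<in>Poly_Mapping.keys t. Poly_Mapping.lookup t T * lim (\<lambda>n. graph_moment M n (W n) T))"
      by (intro sum.cong refl) (use t same in auto)
    also have "\<dots> = limiting_traffic_distribution M W t"
      by (rule traffic_distribution_tendsto[symmetric])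
        (use t convW in \<open>auto simp: convergent_LIMSEQ_iff[symmetric]\<close>)
    finally show ?thesis .
  qed
  then show ?thesis
    unfolding converges_in_traffic_def
    using conv\<Theta> convW star_test_graphs_mono[OF sub] by blast
qed

end
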